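(* Each bounded derivation $D\in\mathcal{D}(A(\mathbb{D}))$ from the disc algebra to its dual is approximable, and hence compact.
   Context: $\mathbb{D}$ is the open unit disc in $\mathbb{C}$ and $\Delta$ its closure. $A(\mathbb{D})$ is the disc algebra: all functions continuous on $\Delta$ and analytic on $\mathbb{D}$, with the supremum norm. A bounded derivation $D: A(\mathbb{D})\to A(\mathbb{D})^*$ is a bounded linear map with $D(fg)=f\cdot D(g)+g\cdot D(f)$, where the module action on the dual is $(f\cdot\varphi)(k)=\varphi(fk)$; i.e. $D(fg)(k)=D(g)(fk)+D(f)(gk)$ for all $f,g,k\in A(\mathbb{D})$. $\mathcal{D}(A(\mathbb{D}))$ is the space of all such bounded derivations. A bounded linear operator between Banach spaces is approximable if it is a limit, in the operator norm, of bounded finite-rank linear operators. *)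

theory Defs
  imports "HOL-Complex_Analysis.Complex_Analysis"
begin

section \<open>Complex normed spaces and bounded operators\<close>

class scaleC =
  fixes scaleC :: "complex \<Rightarrow> 'a \<Rightarrow> 'a" (infixr "*\<^sub>C" 75)

class complex_normed_space = real_normed_vector + scaleC +
  assumes scaleC_add_right: "a *\<^sub>C (x + y) = a *\<^sub>C x + a *\<^sub>C y"
    and scaleC_add_left: "(a + b) *\<^sub>C x = a *\<^sub>C x + b *\<^sub>C x"
    and scaleC_scaleC: "a *\<^sub>C b *\<^sub>C x = (a * b) *\<^sub>C x"
    and scaleC_one: "1 *\<^sub>C x = x"
    and scaleR_scaleC: "r *\<^sub>R x = complex_of_real r *\<^sub>C x"
    and norm_scaleC: "norm (a *\<^sub>C x) = cmod a * norm x"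

global_interpretation complex_vector:
  vector_space "scaleC :: complex \<Rightarrow> 'a \<Rightarrow> 'a::complex_normed_space"
  by unfold_locales (simp_all add: scaleC_add_right scaleC_add_left scaleC_scaleC scaleC_one)

instantiation complex :: complex_normed_space
begin

definition scaleC_complex :: "complex \<Rightarrow> complex \<Rightarrow> complex"
  where "scaleC_complex a z = a * z"

instance
  by standard (simp_all add: scaleC_complex_def algebra_simps norm_mult scaleR_conv_of_real)

end

definition bounded_clinear ::
    "('a::complex_normed_space \<Rightarrow> 'b::complex_normed_space) \<Rightarrow> bool"
  where "bounded_clinear T \<longleftrightarrow> bounded_linear T \<and> (\<forall>c x. T (c *\<^sub>C x) = c *\<^sub>C T x)"

definition finite_rank ::
    "('a::complex_normed_space \<Rightarrow> 'b::complex_normed_space) \<Rightarrow> bool"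
  where "finite_rank T \<longleftrightarrow> (\<exists>B. finite B \<and> range T \<subseteq> complex_vector.span B)"

definition approximable ::
    "('a::complex_normed_space \<Rightarrow> 'b::complex_normed_space) \<Rightarrow> bool"
  where "approximable T \<longleftrightarrow> bounded_clinear T \<and>
    (\<exists>F :: nat \<Rightarrow> 'a \<Rightarrow> 'b. (\<forall>n. bounded_clinear (F n) \<and> finite_rank (F n)) \<and>
      (\<lambda>n. onorm (\<lambda>x. T x - F n x)) \<longlonglongrightarrow> 0)"

definition compact_operator ::
    "('a::complex_normed_space \<Rightarrow> 'b::complex_normed_space) \<Rightarrow> bool"
  where "compact_operator T \<longleftrightarrow> bounded_clinear T \<and> compact (closure (T ` cball 0 1))"

section \<open>The dual space\<close>

typedef (overloaded) 'a cdual = "{\<phi> :: 'a::complex_normed_space \<Rightarrow> complex. bounded_clinear \<phi>}"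
  morphisms cdual_apply Abs_cdual
  by (rule exI[of _ "\<lambda>_. 0"]) (simp add: bounded_clinear_def scaleC_complex_def)

setup_lifting type_definition_cdual

instantiation cdual :: (complex_normed_space) complex_normed_space
begin

lift_definition zero_cdual :: "'a cdual" is "\<lambda>_. 0"
  by (simp add: bounded_clinear_def scaleC_complex_def)

lift_definition plus_cdual :: "'a cdual \<Rightarrow> 'a cdual \<Rightarrow> 'a cdual" is "\<lambda>\<phi> \<psi> x. \<phi> x + \<psi> x"
  by (simp add: bounded_clinear_def scaleC_add_right bounded_linear_add)

lift_definition minus_cdual :: "'a cdual \<Rightarrow> 'a cdual \<Rightarrow> 'a cdual" is "\<lambda>\<phi> \<psi> x. \<phi> x - \<psi> x"
  by (simp add: bounded_clinear_def scaleC_complex_def bounded_linear_sub algebra_simps)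

lift_definition uminus_cdual :: "'a cdual \<Rightarrow> 'a cdual" is "\<lambda>\<phi> x. - \<phi> x"
  by (simp add: bounded_clinear_def scaleC_complex_def bounded_linear_minus)

lift_definition scaleC_cdual :: "complex \<Rightarrow> 'a cdual \<Rightarrow> 'a cdual" is "\<lambda>c \<phi> x. c * \<phi> x"
  by (simp add: bounded_clinear_def scaleC_complex_def bounded_linear_const_mult)

definition scaleR_cdual :: "real \<Rightarrow> 'a cdual \<Rightarrow> 'a cdual"
  where "scaleR_cdual r \<phi> = complex_of_real r *\<^sub>C \<phi>"

lift_definition norm_cdual :: "'a cdual \<Rightarrow> real" is onorm .

definition dist_cdual :: "'a cdual \<Rightarrow> 'a cdual \<Rightarrow> real"
  where "dist_cdual \<phi> \<psi> = norm (\<phi> - \<psi>)"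

definition sgn_cdual :: "'a cdual \<Rightarrow> 'a cdual"
  where "sgn_cdual \<phi> = inverse (norm \<phi>) *\<^sub>R \<phi>"

definition [code del]:
  "(uniformity :: ('a cdual \<times> 'a cdual) filter) = (INF e\<in>{0<..}. principal {(x, y). dist x y < e})"

definition open_cdual :: "'a cdual set \<Rightarrow> bool"
  where [code del]: "open_cdual S = (\<forall>x\<in>S. \<forall>\<^sub>F (x', y) in uniformity. x' = x \<longrightarrow> y \<in> S)"

instance
proof
  fix \<phi> \<psi> \<theta> :: "'a cdual" and a b :: complex and r s :: real
  have scale: "norm (c *\<^sub>C \<xi>) = cmod c * norm \<xi>" for c and \<xi> :: "'a cdual"
  proof transfer
    fix c and \<xi> :: "'a \<Rightarrow> complex"
    assume "bounded_clinear \<xi>"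
    then have bl: "bounded_linear \<xi>" by (simp add: bounded_clinear_def)
    have le: "onorm (\<lambda>x. d * \<eta> x) \<le> cmod d * onorm \<eta>" if "bounded_linear \<eta>"
      for d and \<eta> :: "'a \<Rightarrow> complex"
    proof (rule onorm_bound)
      show "0 \<le> cmod d * onorm \<eta>" using that by (simp add: onorm_pos_le)
      show "norm (d * \<eta> x) \<le> cmod d * onorm \<eta> * norm x" for x
        using onorm[OF that, of x] by (simp add: norm_mult mult.assoc mult_left_mono)
    qed
    show "onorm (\<lambda>x. c * \<xi> x) = cmod c * onorm \<xi>"
    proof (cases "c = 0")
      case True
      then show ?thesis by (simp add: onorm_zero)
    next
      case False
      have "onorm \<xi> = onorm (\<lambda>x. inverse c * (c * \<xi> x))"
        using False by (simp add: field_simps)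
      also have "\<dots> \<le> cmod (inverse c) * onorm (\<lambda>x. c * \<xi> x)"
        by (rule le) (rule bounded_linear_const_mult[OF bl])
      finally have "cmod c * onorm \<xi> \<le> onorm (\<lambda>x. c * \<xi> x)"
        using False by (simp add: norm_divide divide_simps mult.commute)
      with le[OF bl, of c] show ?thesis by linarith
    qed
  qed
  show "\<phi> + \<psi> + \<theta> = \<phi> + (\<psi> + \<theta>)" by transfer (simp add: add.assoc)
  show "\<phi> + \<psi> = \<psi> + \<phi>" by transfer (simp add: add.commute)
  show "0 + \<phi> = \<phi>" by transfer simp
  show "- \<phi> + \<phi> = 0" by transfer simp
  show "\<phi> - \<psi> = \<phi> + - \<psi>" by transfer simp
  show C: "a *\<^sub>C (\<phi> + \<psi>) = a *\<^sub>C \<phi> + a *\<^sub>C \<psi>" for a and \<phi> \<psi> :: "'a cdual"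
    by transfer (simp add: algebra_simps)
  show D: "(a + b) *\<^sub>C \<phi> = a *\<^sub>C \<phi> + b *\<^sub>C \<phi>" for a b and \<phi> :: "'a cdual"
    by transfer (simp add: algebra_simps)
  show E: "a *\<^sub>C b *\<^sub>C \<phi> = (a * b) *\<^sub>C \<phi>" for a b and \<phi> :: "'a cdual"
    by transfer (simp add: algebra_simps)
  show F: "1 *\<^sub>C \<phi> = \<phi>" for \<phi> :: "'a cdual" by transfer simp
  show "r *\<^sub>R \<phi> = complex_of_real r *\<^sub>C \<phi>" by (rule scaleR_cdual_def)
  show "norm (a *\<^sub>C \<phi>) = cmod a * norm \<phi>" by (rule scale)
  show "r *\<^sub>R (\<phi> + \<psi>) = r *\<^sub>R \<phi> + r *\<^sub>R \<psi>" by (simp add: scaleR_cdual_def C)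
  show "(r + s) *\<^sub>R \<phi> = r *\<^sub>R \<phi> + s *\<^sub>R \<phi>" by (simp add: scaleR_cdual_def D)
  show "r *\<^sub>R s *\<^sub>R \<phi> = (r * s) *\<^sub>R \<phi>" by (simp add: scaleR_cdual_def E)
  show "1 *\<^sub>R \<phi> = \<phi>" by (simp add: scaleR_cdual_def F)
  show "norm (r *\<^sub>R \<phi>) = \<bar>r\<bar> * norm \<phi>" by (simp add: scaleR_cdual_def scale)
  show "norm (\<phi> + \<psi>) \<le> norm \<phi> + norm \<psi>"
    by transfer (simp add: bounded_clinear_def onorm_triangle)
  show "norm \<phi> = 0 \<longleftrightarrow> \<phi> = 0"
    by transfer (auto simp: bounded_clinear_def onorm_eq_0)
  show "dist \<phi> \<psi> = norm (\<phi> - \<psi>)" by (rule dist_cdual_def)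
  show "sgn \<phi> = inverse (norm \<phi>) *\<^sub>R \<phi>" by (rule sgn_cdual_def)
  show "(uniformity :: ('a cdual \<times> 'a cdual) filter) =
      (INF e\<in>{0<..}. principal {(x, y). dist x y < e})"
    by (rule uniformity_cdual_def)
  show "open U \<longleftrightarrow> (\<forall>x\<in>U. \<forall>\<^sub>F (x', y) in uniformity. x' = x \<longrightarrow> y \<in> U)" for U :: "'a cdual set"
    by (rule open_cdual_def)
qed

end

section \<open>The disc algebra\<close>

text \<open>Elements are functions on the closed disc; the value 0 outside it only makes the
  representing total function unique.\<close>

typedef disc_algebra =
  "{f :: complex \<Rightarrow> complex. continuous_on (cball 0 1) f \<and> f holomorphic_on ball 0 1 \<and>
     (\<forall>z. z \<notin> cball 0 1 \<longrightarrow> f z = 0)}"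
  morphisms disc_fun Abs_disc_algebra
  by (rule exI[of _ "\<lambda>_. 0"]) simp

setup_lifting type_definition_disc_algebra

instantiation disc_algebra :: comm_ring
begin

lift_definition zero_disc_algebra :: disc_algebra is "\<lambda>_. 0"
  by simp

lift_definition plus_disc_algebra :: "disc_algebra \<Rightarrow> disc_algebra \<Rightarrow> disc_algebra"
  is "\<lambda>f g z. f z + g z"
  by (auto intro!: continuous_intros holomorphic_intros)

lift_definition minus_disc_algebra :: "disc_algebra \<Rightarrow> disc_algebra \<Rightarrow> disc_algebra"
  is "\<lambda>f g z. f z - g z"
  by (auto intro!: continuous_intros holomorphic_intros)

lift_definition uminus_disc_algebra :: "disc_algebra \<Rightarrow> disc_algebra" is "\<lambda>f z. - f z"
  by (auto intro!: continuous_intros holomorphic_intros)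

lift_definition times_disc_algebra :: "disc_algebra \<Rightarrow> disc_algebra \<Rightarrow> disc_algebra"
  is "\<lambda>f g z. f z * g z"
  by (auto intro!: continuous_intros holomorphic_intros)

instance
  by standard (transfer; simp add: algebra_simps)+

end

lemma bdd_above_disc_fun: "bdd_above ((\<lambda>z. cmod (disc_fun f z)) ` cball 0 1)"
proof -
  have "continuous_on (cball 0 1) (\<lambda>z. cmod (disc_fun f z))"
    using disc_fun[of f] by (auto intro: continuous_on_norm)
  then show ?thesis
    by (intro bounded_imp_bdd_above compact_imp_bounded compact_continuous_image) auto
qed

instantiation disc_algebra :: "{complex_normed_space, real_normed_algebra}"
begin

lift_definition scaleC_disc_algebra :: "complex \<Rightarrow> disc_algebra \<Rightarrow> disc_algebra"
  is "\<lambda>c f z. c * f z"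
  by (auto intro!: continuous_intros holomorphic_intros)

definition scaleR_disc_algebra :: "real \<Rightarrow> disc_algebra \<Rightarrow> disc_algebra"
  where "scaleR_disc_algebra r f = complex_of_real r *\<^sub>C f"

definition norm_disc_algebra :: "disc_algebra \<Rightarrow> real"
  where "norm_disc_algebra f = (SUP z\<in>cball 0 1. cmod (disc_fun f z))"

definition dist_disc_algebra :: "disc_algebra \<Rightarrow> disc_algebra \<Rightarrow> real"
  where "dist_disc_algebra f g = norm (f - g)"

definition sgn_disc_algebra :: "disc_algebra \<Rightarrow> disc_algebra"
  where "sgn_disc_algebra f = inverse (norm f) *\<^sub>R f"

definition [code del]:
  "(uniformity :: (disc_algebra \<times> disc_algebra) filter) =
    (INF e\<in>{0<..}. principal {(x, y). dist x y < e})"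

definition open_disc_algebra :: "disc_algebra set \<Rightarrow> bool"
  where [code del]:
    "open_disc_algebra S = (\<forall>x\<in>S. \<forall>\<^sub>F (x', y) in uniformity. x' = x \<longrightarrow> y \<in> S)"

instance
proof
  fix f g :: disc_algebra and a :: complex and r s :: real
  have upper: "cmod (disc_fun f z) \<le> norm f" if "z \<in> cball 0 1" for f z
    unfolding norm_disc_algebra_def by (rule cSUP_upper[OF that bdd_above_disc_fun])
  have least: "norm f \<le> M" if "\<And>z. z \<in> cball 0 1 \<Longrightarrow> cmod (disc_fun f z) \<le> M" for f M
    unfolding norm_disc_algebra_def by (rule cSUP_least) (use that in auto)
  have nonneg: "0 \<le> norm f" for f :: disc_algebra
    using upper[of 0 f] norm_ge_zero[of "disc_fun f 0"] by (simp del: norm_ge_zero)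
  have le: "norm (c *\<^sub>C f) \<le> cmod c * norm f" for c and f :: disc_algebra
    by (rule least) (simp add: scaleC_disc_algebra.rep_eq norm_mult mult_left_mono upper)
  show C: "a *\<^sub>C (f + g) = a *\<^sub>C f + a *\<^sub>C g" for a and f g :: disc_algebra
    by transfer (simp add: algebra_simps)
  show D: "(a + b) *\<^sub>C f = a *\<^sub>C f + b *\<^sub>C f" for a b and f :: disc_algebra
    by transfer (simp add: algebra_simps)
  show E: "a *\<^sub>C b *\<^sub>C f = (a * b) *\<^sub>C f" for a b and f :: disc_algebra
    by transfer (simp add: algebra_simps)
  show F: "1 *\<^sub>C f = f" for f :: disc_algebra
    by transfer simp
  have scale: "norm (c *\<^sub>C f) = cmod c * norm f" for c and f :: disc_algebra
  proof (cases "c = 0")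
    case True
    then show ?thesis using le[of c f] nonneg[of "c *\<^sub>C f"] by simp
  next
    case False
    have "norm f \<le> cmod (inverse c) * norm (c *\<^sub>C f)"
      using le[of "inverse c" "c *\<^sub>C f"] False by (simp add: E F)
    then have "cmod c * norm f \<le> norm (c *\<^sub>C f)"
      using False by (simp add: norm_divide divide_simps mult.commute)
    with le[of c f] show ?thesis by linarith
  qed
  show "r *\<^sub>R f = complex_of_real r *\<^sub>C f" by (rule scaleR_disc_algebra_def)
  show "norm (a *\<^sub>C f) = cmod a * norm f" by (rule scale)
  show "r *\<^sub>R (f + g) = r *\<^sub>R f + r *\<^sub>R g" by (simp add: scaleR_disc_algebra_def C)
  show "(r + s) *\<^sub>R f = r *\<^sub>R f + s *\<^sub>R f" by (simp add: scaleR_disc_algebra_def D)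
  show "r *\<^sub>R s *\<^sub>R f = (r * s) *\<^sub>R f" by (simp add: scaleR_disc_algebra_def E)
  show "1 *\<^sub>R f = f" by (simp add: scaleR_disc_algebra_def F)
  show "r *\<^sub>R f * g = r *\<^sub>R (f * g)"
    unfolding scaleR_disc_algebra_def by transfer (simp add: algebra_simps)
  show "f * r *\<^sub>R g = r *\<^sub>R (f * g)"
    unfolding scaleR_disc_algebra_def by transfer (simp add: algebra_simps)
  show "norm (r *\<^sub>R f) = \<bar>r\<bar> * norm f" by (simp add: scaleR_disc_algebra_def scale)
  show "norm (f + g) \<le> norm f + norm g"
    by (rule least, unfold plus_disc_algebra.rep_eq) (intro norm_triangle_le add_mono upper)
  show "norm (f * g) \<le> norm f * norm g"
    by (rule least, unfold times_disc_algebra.rep_eq norm_mult)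
      (intro mult_mono upper nonneg norm_ge_zero)
  show "norm f = 0 \<longleftrightarrow> f = 0"
  proof
    assume "norm f = 0"
    then have "disc_fun f z = 0" if "z \<in> cball 0 1" for z using upper[OF that, of f] by simp
    moreover have "disc_fun f z = 0" if "z \<notin> cball 0 1" for z
      using disc_fun[of f] that by blast
    ultimately have "disc_fun f = disc_fun 0"
      by (intro ext) (metis zero_disc_algebra.rep_eq)
    then show "f = 0" by (simp only: disc_fun_inject)
  qed (simp add: norm_disc_algebra_def zero_disc_algebra.rep_eq)
  show "dist f g = norm (f - g)" by (rule dist_disc_algebra_def)
  show "sgn f = inverse (norm f) *\<^sub>R f" by (rule sgn_disc_algebra_def)
  show "(uniformity :: (disc_algebra \<times> disc_algebra) filter) =
      (INF e\<in>{0<..}. principal {(x, y). dist x y < e})"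
    by (rule uniformity_disc_algebra_def)
  show "open U \<longleftrightarrow> (\<forall>x\<in>U. \<forall>\<^sub>F (x', y) in uniformity. x' = x \<longrightarrow> y \<in> U)"
    for U :: "disc_algebra set"
    by (rule open_disc_algebra_def)
qed

end

section \<open>Derivations into the dual module\<close>

definition module_action :: "disc_algebra \<Rightarrow> disc_algebra cdual \<Rightarrow> disc_algebra cdual"
    (infixr "\<cdot>" 75)
  where "f \<cdot> \<phi> = Abs_cdual (\<lambda>k. cdual_apply \<phi> (f * k))"

lemma cdual_apply_module_action: "cdual_apply (f \<cdot> \<phi>) k = cdual_apply \<phi> (f * k)"
proof -
  have "f * (c *\<^sub>C h) = c *\<^sub>C (f * h)" for c h
    by transfer (simp add: algebra_simps)
  moreover have "bounded_clinear (cdual_apply \<phi>)"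
    using cdual_apply[of \<phi>] by simp
  moreover from this have "bounded_linear (\<lambda>k. cdual_apply \<phi> (f * k))"
    unfolding bounded_clinear_def
    by (elim conjE) (rule bounded_linear_compose[OF _ bounded_linear_mult_right])
  ultimately have "bounded_clinear (\<lambda>k. cdual_apply \<phi> (f * k))"
    by (simp only: bounded_clinear_def simp_thms)
  then show ?thesis
    by (simp add: module_action_def Abs_cdual_inverse)
qed

definition bounded_derivations :: "(disc_algebra \<Rightarrow> disc_algebra cdual) set"
  where "bounded_derivations =
    {D. bounded_clinear D \<and> (\<forall>f g. D (f * g) = f \<cdot> D g + g \<cdot> D f)}"

end

theory Submission
  imports Defs
begin


text \<open>
  Put \<open>a n = D (z ^ n) 1\<close>, so that \<open>D f g\<close> is the pairing of \<open>f' * g\<close> with the sequence \<open>a (n + 1) / (n + 1)\<close>.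
  Since \<open>D k 1 = D (exp k) (exp (- k))\<close>, the functional \<open>k \<mapsto> D k 1\<close> is bounded on functions with bounded
  real part; testing it on averages of Cauchy kernels shows that \<open>\<Sum>n. a n * z ^ n\<close> lies in the Hardy
  space \<open>H\<^sup>1\<close>, hence is a product \<open>F * G\<close> of two \<open>H\<^sup>2\<close> functions. A Littlewood-Paley estimate bounds the
  pairing of \<open>f' * g\<close> with \<open>F * G\<close> by \<open>\<parallel>f\<parallel> * \<parallel>g\<parallel> * \<parallel>F\<parallel> * \<parallel>G\<parallel>\<close>, with sup norms for \<open>f\<close>, \<open>g\<close> and \<open>H\<^sup>2\<close> norms for
  \<open>F\<close>, \<open>G\<close>. Truncating the Taylor series of \<open>F\<close> and \<open>G\<close> therefore approximates \<open>D\<close> in norm by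
  operators of finite rank. Averages over circles are replaced throughout by averages over roots of
  unity.
\<close>

section \<open>Paraproduct estimate\<close>

text \<open>The difficulty is the derivative in the pairing: \<open>f\<close> and \<open>g\<close>
  are only bounded, so \<open>f' * g\<close> has no usable norm of its own. Writing the symbol as
  \<open>F * G\<close> resolves this. Its derivative is \<open>F' * G + F * G'\<close>, so each term
  contains the derivative of one H^2 function and the product of \<open>f'\<close> with another; up
  to conjugation of coefficients, \<open>f' * F\<close> differs from \<open>(f * F)'\<close> by
  \<open>f * F'\<close>, hence is again controlled by derivatives of H^2 functions. The weight
  \<open>1 / (m + 1)^2\<close> absorbs these two derivatives, one on each side of the pairing. The
  factorization is also what makes truncation work: Taylor partial sums converge in H^2, but need
  not even be bounded in H^1. The estimate is stated for polynomials only, since they are dense and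
  its constant does not depend on their degrees; an average over N-th roots of unity is then exact
  as soon as N exceeds the degrees.\<close>

lemma sum_root_of_unity_powers:
  assumes "0 < d" "d < N"
  shows "(\<Sum>m<N. (cis (2 * pi / real N) ^ m) ^ d) = 0"
proof -
  let ?w = "cis (2 * pi / real N)"
  have N: "N > 0" using assms by simp
  have "?w ^ d = exp (2 * of_real pi * \<i> * of_nat d / of_nat N)"
    by (simp only: cis_conv_exp exp_of_nat_mult [symmetric]) (simp add: field_simps)
  also have "\<dots> \<noteq> 1"
    using assms complex_root_unity_eq_1[of N d] by (auto dest: dvd_imp_le)
  finally have ne: "?w ^ d \<noteq> 1" .
  have "?w ^ N = 1" using N by (simp add: Complex.DeMoivre)
  then have 1: "(?w ^ d) ^ N = 1" by (metis mult.commute power_mult power_one)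
  have "(\<Sum>m<N. (?w ^ m) ^ d) = (\<Sum>m<N. (?w ^ d) ^ m)"
    by (simp add: power_mult [symmetric] mult.commute)
  also have "\<dots> = 0" using ne 1 by (simp add: geometric_sum)
  finally show ?thesis .
qed

text \<open>Both exponents lie below \<open>N\<close>, so \<open>i - j\<close> is never a nonzero
  multiple of \<open>N\<close>: there is no aliasing. The case \<open>i < j\<close> is the conjugate
  of the case \<open>j < i\<close>.\<close>

lemma sum_root_of_unity_orthogonal:
  assumes "i < N" "j < N"
  shows "(\<Sum>m<N. (cis (2 * pi / real N) ^ m) ^ i * cnj (cis (2 * pi / real N) ^ m) ^ j)
    = (if i = j then of_nat N else 0)"
proof -
  let ?w = "cis (2 * pi / real N)"
  have c: "z * cnj z = 1" if "cmod z = 1" for z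
    using that by (simp add: complex_norm_square [symmetric])
  have n: "cmod (?w ^ m) = 1" for m by (simp add: norm_power)
  have le: "(\<Sum>m<N. (?w ^ m) ^ i * cnj (?w ^ m) ^ j) = (\<Sum>m<N. (?w ^ m) ^ (i - j))"
    if "j \<le> i" for i j
  proof (rule sum.cong)
    fix m
    have "(?w ^ m) ^ i = (?w ^ m) ^ (i - j) * (?w ^ m) ^ j"
      using that by (simp add: power_add [symmetric])
    then show "(?w ^ m) ^ i * cnj (?w ^ m) ^ j = (?w ^ m) ^ (i - j)"
      using c[OF n[of m]] by (metis mult.assoc mult.right_neutral power_mult_distrib power_one)
  qed simp
  show ?thesis
  proof (cases "j \<le> i")
    case True
    then show ?thesis
      using sum_root_of_unity_powers[of "i - j" N] assms le[OF True] by (cases "i = j") auto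
  next
    case False
    have "(\<Sum>m<N. (?w ^ m) ^ i * cnj (?w ^ m) ^ j) =
        cnj (\<Sum>m<N. (?w ^ m) ^ j * cnj (?w ^ m) ^ i)"
      by (simp add: mult.commute)
    also have "\<dots> = 0"
      using False le[of i j] sum_root_of_unity_powers[of "j - i" N] assms by auto
    finally show ?thesis using False by auto
  qed
qed

section \<open>Parseval's identity over roots of unity\<close>

lemma poly_eq_sum_lessThan:
  fixes p :: "'a::comm_semiring_1 poly"
  assumes "degree p < N"
  shows "poly p x = (\<Sum>i<N. coeff p i * x ^ i)"
proof -
  have "poly p x = (\<Sum>i\<le>degree p. coeff p i * x ^ i)" by (rule poly_altdef)
  also have "\<dots> = (\<Sum>i<N. coeff p i * x ^ i)"
    using assms by (intro sum.mono_neutral_left) (auto simp: coeff_eq_0)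
  finally show ?thesis .
qed

text \<open>By orthogonality only products of equal powers survive. Conjugating the point and not
  the value keeps the identity bilinear, so the coefficients of \<open>q\<close> appear
  unconjugated.\<close>

lemma sum_roots_poly_pairing:
  fixes p q :: "complex poly" and r :: complex
  assumes "degree p < N" "degree q < N"
  defines "w \<equiv> cis (2 * pi / real N)"
  shows "(\<Sum>m<N. poly p (r * w ^ m) * poly q (r * cnj (w ^ m))) =
    of_nat N * (\<Sum>i<N. coeff p i * coeff q i * r ^ (2 * i))"
proof -
  have "(\<Sum>m<N. poly p (r * w ^ m) * poly q (r * cnj (w ^ m))) =
      (\<Sum>m<N. \<Sum>i<N. \<Sum>j<N. coeff p i * coeff q j * r ^ (i + j) * ((w ^ m) ^ i * cnj (w ^ m) ^ j))"
    by (simp add: poly_eq_sum_lessThan[OF assms(1)] poly_eq_sum_lessThan[OF assms(2)]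
        sum_product power_mult_distrib power_add mult_ac del: complex_cnj_power)
  also have "\<dots> = (\<Sum>i<N. \<Sum>m<N. \<Sum>j<N. coeff p i * coeff q j * r ^ (i + j) * ((w ^ m) ^ i * cnj (w ^ m) ^ j))"
    by (rule sum.swap)
  also have "\<dots> = (\<Sum>i<N. \<Sum>j<N. \<Sum>m<N. coeff p i * coeff q j * r ^ (i + j) * ((w ^ m) ^ i * cnj (w ^ m) ^ j))"
    by (intro sum.cong sum.swap refl)
  also have "\<dots> = (\<Sum>i<N. \<Sum>j<N. coeff p i * coeff q j * r ^ (i + j) * (if i = j then of_nat N else 0))"
    unfolding w_def sum_distrib_left [symmetric]
    by (intro sum.cong refl) (subst sum_root_of_unity_orthogonal; simp)
  also have "\<dots> = (\<Sum>i<N. coeff p i * coeff q i * r ^ (2 * i) * of_nat N)"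
    by (intro sum.cong refl) (simp add: if_distrib mult_2 cong: if_cong)
  finally show ?thesis by (simp add: sum_distrib_left mult_ac)
qed

definition cnj_poly :: "complex poly \<Rightarrow> complex poly" where "cnj_poly = map_poly cnj"

lemma coeff_cnj_poly [simp]: "coeff (cnj_poly p) n = cnj (coeff p n)"
  by (simp add: cnj_poly_def coeff_map_poly)

lemma degree_cnj_poly [simp]: "degree (cnj_poly p) = degree p"
  by (simp add: cnj_poly_def degree_map_poly)

lemma poly_cnj_poly: "poly (cnj_poly p) (cnj z) = cnj (poly p z)"
  by (simp add: poly_altdef)

text \<open>Parseval on the circle of radius \<open>r\<close>: this is
  \<open>sum_roots_poly_pairing\<close> with \<open>q = cnj_poly p\<close>, because
  \<open>cnj (poly p z)\<close> is the value of \<open>cnj_poly p\<close> at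
  \<open>cnj z\<close>.\<close>

lemma sum_roots_poly_norm:
  fixes p :: "complex poly" and r :: real
  assumes "degree p < N"
  defines "w \<equiv> cis (2 * pi / real N)"
  shows "(\<Sum>m<N. (cmod (poly p (complex_of_real r * w ^ m)))\<^sup>2) =
    real N * (\<Sum>i<N. (cmod (coeff p i))\<^sup>2 * r ^ (2 * i))"
proof -
  have "complex_of_real (\<Sum>m<N. (cmod (poly p (of_real r * w ^ m)))\<^sup>2) =
      (\<Sum>m<N. poly p (r * w ^ m) * poly (cnj_poly p) (r * cnj (w ^ m)))"
    unfolding of_real_sum
  proof (intro sum.cong refl)
    fix m
    have "cnj (of_real r * w ^ m) = of_real r * cnj (w ^ m)" by simp
    then show "complex_of_real ((cmod (poly p (of_real r * w ^ m)))\<^sup>2) =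
        poly p (of_real r * w ^ m) * poly (cnj_poly p) (of_real r * cnj (w ^ m))"
      by (metis complex_norm_square poly_cnj_poly)
  qed
  also have "\<dots> = of_nat N * (\<Sum>i<N. coeff p i * coeff (cnj_poly p) i * of_real r ^ (2 * i))"
    unfolding w_def by (rule sum_roots_poly_pairing) (use assms in auto)
  also have "\<dots> = complex_of_real (real N * (\<Sum>i<N. (cmod (coeff p i))\<^sup>2 * r ^ (2 * i)))"
    by (simp only: of_real_mult of_real_sum of_real_of_nat_eq of_real_power coeff_cnj_poly
        complex_norm_square [unfolded of_real_power])
  finally show ?thesis using of_real_eq_iff by blast
qed

text \<open>Dividing the coefficients by \<open>(m + 1)\<^sup>2\<close> and evaluating at 1 amounts to integrating \<open>c (x * y)\<close>
  over the unit square, which preserves positivity.\<close>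

lemma sum_div_Suc_nonneg:
  fixes c :: "nat \<Rightarrow> real"
  assumes nn: "\<And>s. \<lbrakk>0 \<le> s; s \<le> 1\<rbrakk> \<Longrightarrow> 0 \<le> (\<Sum>m<K. c m * s ^ m)"
    and s: "0 \<le> s" "s \<le> 1"
  shows "0 \<le> (\<Sum>m<K. c m / real (Suc m) * s ^ m)"
proof (cases "s = 0")
  case True
  then show ?thesis
    using nn[of 0] by (cases K) (simp_all add: sum.lessThan_Suc_shift del: sum.lessThan_Suc)
next
  case False
  \<comment> \<open>The primitive of the given polynomial that vanishes at 0; the sum sought is
    \<open>?g s / s\<close>.\<close>
  let ?g = "\<lambda>x::real. \<Sum>m<K. c m / real (Suc m) * x ^ Suc m"
  have d: "(?g has_real_derivative (\<Sum>m<K. c m * x ^ m)) (at x)" for x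
  proof (rule DERIV_sum)
    fix m
    show "((\<lambda>x. c m / real (Suc m) * x ^ Suc m) has_real_derivative c m * x ^ m) (at x)"
      by (rule derivative_eq_intros refl | simp del: of_nat_Suc)+
  qed
  have "?g 0 \<le> ?g s"
    by (rule DERIV_nonneg_imp_nondecreasing[OF s(1)]) (use d nn s in force)
  then have "0 \<le> s * (\<Sum>m<K. c m / real (Suc m) * s ^ m)"
    by (simp add: sum_distrib_left mult_ac)
  then show ?thesis using False s by (simp add: zero_le_mult_iff)
qed

lemma sum_div_Suc_square_nonneg:
  fixes c :: "nat \<Rightarrow> real"
  assumes "\<And>s. \<lbrakk>0 \<le> s; s \<le> 1\<rbrakk> \<Longrightarrow> 0 \<le> (\<Sum>m<K. c m * s ^ m)"
  shows "0 \<le> (\<Sum>m<K. c m / (real (Suc m))\<^sup>2)"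
proof -
  have "0 \<le> (\<Sum>m<K. c m / real (Suc m) / real (Suc m) * 1 ^ m)"
    by (rule sum_div_Suc_nonneg[OF sum_div_Suc_nonneg[OF assms]]) auto
  then show ?thesis by (simp add: power2_eq_square)
qed

text \<open>The numbers \<open>1 / (m + 1)^2\<close> are the moments of the positive measure
  \<open>- ln s ds\<close> on the unit interval, so this is the triangle inequality for an integral.
  One unimodular \<open>t\<close> turns the whole sum into its modulus, and positivity is applied to
  \<open>d m - Re (t * c m)\<close>.\<close>

lemma norm_sum_div_Suc_square_le:
  fixes c :: "nat \<Rightarrow> complex" and d :: "nat \<Rightarrow> real"
  assumes "\<And>s. \<lbrakk>0 \<le> s; s \<le> 1\<rbrakk> \<Longrightarrow> cmod (\<Sum>m<K. c m * of_real s ^ m) \<le> (\<Sum>m<K. d m * s ^ m)"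
  shows "cmod (\<Sum>m<K. c m / (of_nat (Suc m))\<^sup>2) \<le> (\<Sum>m<K. d m / (real (Suc m))\<^sup>2)"
proof -
  define S where "S = (\<Sum>m<K. c m / (of_nat (Suc m))\<^sup>2)"
  define t where "t = (if S = 0 then 1 else cnj S / of_real (cmod S))"
  have t1: "cmod t = 1" by (simp add: t_def norm_divide)
  have tS: "t * S = of_real (cmod S)"
    by (simp add: t_def complex_norm_square [symmetric] mult.commute power2_eq_square)
  have "0 \<le> (\<Sum>m<K. (d m - Re (t * c m)) / (real (Suc m))\<^sup>2)"
  proof (rule sum_div_Suc_square_nonneg)
    fix s :: real assume s: "0 \<le> s" "s \<le> 1"
    have "(\<Sum>m<K. Re (t * c m) * s ^ m) = Re (t * (\<Sum>m<K. c m * of_real s ^ m))"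
      by (simp add: sum_distrib_left mult.assoc [symmetric] flip: of_real_power)
    also have "\<dots> \<le> cmod (t * (\<Sum>m<K. c m * of_real s ^ m))" by (rule complex_Re_le_cmod)
    also have "\<dots> \<le> (\<Sum>m<K. d m * s ^ m)" using assms[OF s] t1 by (simp add: norm_mult)
    finally show "0 \<le> (\<Sum>m<K. (d m - Re (t * c m)) * s ^ m)"
      by (simp add: left_diff_distrib sum_subtractf)
  qed
  moreover have "(\<Sum>m<K. Re (t * c m) / (real (Suc m))\<^sup>2) = Re (t * S)"
    unfolding S_def sum_distrib_left Re_sum
  proof (intro sum.cong refl)
    fix m
    have "t * (c m / (of_nat (Suc m))\<^sup>2) = t * c m / of_real ((real (Suc m))\<^sup>2)" by simp
    then show "Re (t * c m) / (real (Suc m))\<^sup>2 = Re (t * (c m / (of_nat (Suc m))\<^sup>2))"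
      by (simp only: Re_divide_of_real)
  qed
  ultimately show ?thesis
    by (simp add: tS diff_divide_distrib sum_subtractf flip: S_def del: of_nat_Suc times_complex.sel)
qed

text \<open>Multiplication by a function bounded by 1 contracts the H^2 norm: the values at the
  roots of unity are compared, with Parseval at radius 1 on both sides.\<close>

lemma sum_norm_coeff_mult_le:
  fixes u p :: "complex poly"
  assumes "\<And>z. cmod z \<le> 1 \<Longrightarrow> cmod (poly u z) \<le> 1"
    and "degree p < N" "degree (u * p) < N"
  shows "(\<Sum>i<N. (cmod (coeff (u * p) i))\<^sup>2) \<le> (\<Sum>i<N. (cmod (coeff p i))\<^sup>2)"
proof -
  let ?w = "cis (2 * pi / real N)"
  have "real N * (\<Sum>i<N. (cmod (coeff (u * p) i))\<^sup>2) = (\<Sum>m<N. (cmod (poly (u * p) (?w ^ m)))\<^sup>2)"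
    using sum_roots_poly_norm[OF assms(3), of 1] by simp
  also have "\<dots> \<le> (\<Sum>m<N. (cmod (poly p (?w ^ m)))\<^sup>2)"
  proof (rule sum_mono)
    fix m
    show "(cmod (poly (u * p) (?w ^ m)))\<^sup>2 \<le> (cmod (poly p (?w ^ m)))\<^sup>2"
      using assms(1)[of "?w ^ m"] by (intro power_mono) (auto simp: norm_mult norm_power mult_left_le_one_le)
  qed
  also have "\<dots> = real N * (\<Sum>i<N. (cmod (coeff p i))\<^sup>2)"
    using sum_roots_poly_norm[OF assms(2), of 1] by simp
  finally show ?thesis using assms(2) by simp
qed

text \<open>The weight cancels the factor \<open>m + 1\<close> of the derivative exactly. The
  constant coefficient is lost by differentiation, hence an inequality.\<close>

lemma sum_norm_coeff_pderiv:
  fixes p :: "complex poly"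
  shows "(\<Sum>m<N. (cmod (coeff (pderiv p) m))\<^sup>2 / (real (Suc m))\<^sup>2) \<le> (\<Sum>i<Suc N. (cmod (coeff p i))\<^sup>2)"
proof -
  have "(\<Sum>m<N. (cmod (coeff (pderiv p) m))\<^sup>2 / (real (Suc m))\<^sup>2) = (\<Sum>m<N. (cmod (coeff p (Suc m)))\<^sup>2)"
    by (intro sum.cong refl)
      (simp add: coeff_pderiv norm_mult power_mult_distrib del: of_nat_Suc)
  also have "\<dots> \<le> (\<Sum>i<Suc N. (cmod (coeff p i))\<^sup>2)"
    by (subst sum.lessThan_Suc_shift) simp
  finally show ?thesis .
qed

text \<open>From \<open>u' * p = (u * p)' - u * p'\<close>: the derivative is moved off \<open>u\<close>, about which only the sup norm is known.\<close>

lemma norm_pderiv_mult_le: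
  fixes u p :: "complex poly"
  assumes "cmod (poly u z) \<le> 1"
  shows "(cmod (poly (pderiv u) z * poly p z))\<^sup>2
    \<le> 2 * (cmod (poly (pderiv (u * p)) z))\<^sup>2 + 2 * (cmod (poly (pderiv p) z))\<^sup>2"
proof -
  let ?a = "cmod (poly (pderiv (u * p)) z)" and ?b = "cmod (poly (pderiv p) z)"
  have "poly (pderiv u) z * poly p z = poly (pderiv (u * p)) z - poly u z * poly (pderiv p) z"
    by (simp add: pderiv_mult algebra_simps)
  then have "cmod (poly (pderiv u) z * poly p z) \<le> ?a + cmod (poly u z * poly (pderiv p) z)"
    by (simp only: norm_triangle_ineq4)
  also have "\<dots> \<le> ?a + ?b"
    using assms by (simp add: norm_mult mult_left_le_one_le)
  finally have "(cmod (poly (pderiv u) z * poly p z))\<^sup>2 \<le> (?a + ?b)\<^sup>2" by (simp add: power_mono)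
  also have "\<dots> \<le> 2 * ?a\<^sup>2 + 2 * ?b\<^sup>2"
    using sum_squares_bound[of ?a ?b] by (simp add: power2_sum)
  finally show ?thesis .
qed

text \<open>Since \<open>coeff (F * G) (m + 1)\<close> is
  \<open>coeff (pderiv (F * G)) m / (m + 1)\<close>, the sum carries the weight
  \<open>1 / (m + 1)^2\<close> and reduces to estimates on circles. There \<open>v\<close> is
  bounded by 1, the product rule and \<open>x * y \<le> (x^2 + y^2) / 2\<close> separate the
  factors, and \<open>norm_pderiv_mult_le\<close> removes the derivative from \<open>u\<close>. For
  each of \<open>F\<close> and \<open>G\<close>, the constant 5/2 is 1/2 from its own derivative, 1
  from the derivative of its product with \<open>u\<close>, and 1 from the correction term.\<close>

lemma paraproduct_bound_weak:
  fixes u v F G :: "complex poly"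
  assumes u: "\<And>z. cmod z \<le> 1 \<Longrightarrow> cmod (poly u z) \<le> 1"
    and v: "\<And>z. cmod z \<le> 1 \<Longrightarrow> cmod (poly v z) \<le> 1"
    and N: "degree u + degree v + degree F + degree G < N"
  shows "cmod (\<Sum>m<N. coeff (pderiv u * v) m * coeff (F * G) (Suc m) / of_nat (Suc m))
    \<le> 5 / 2 * ((\<Sum>i<N. (cmod (coeff F i))\<^sup>2) + (\<Sum>i<N. (cmod (coeff G i))\<^sup>2))"
proof -
  define w where "w = cis (2 * pi / real N)"
  have N0: "N > 0" using N by simp
  have dp: "degree (pderiv p) \<le> degree p" for p :: "complex poly" by (simp add: degree_pderiv)
  define sq where "sq = (\<lambda>p m. (cmod (coeff (pderiv p) m))\<^sup>2 :: real)"
  \<comment> \<open>Coefficients of the Parseval majorant. \<open>F\<close> is evaluated at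
    \<open>cnj z\<close> but \<open>u\<close> at \<open>z\<close>; \<open>cnj_poly F\<close> at
    \<open>z\<close> has the same modulus and can be multiplied by \<open>u\<close> as a
    polynomial.\<close>
  define d where "d = (\<lambda>m. (sq F m + sq G m) / 2 + (sq (u * cnj_poly F) m + sq (u * cnj_poly G) m)
     + (sq (cnj_poly F) m + sq (cnj_poly G) m))"
  have deg: "degree p + degree q < N \<Longrightarrow> degree (p * q) < N" for p q :: "complex poly"
    using degree_mult_le[of p q] by simp
  have degu: "degree (u * cnj_poly F) < N" "degree (u * cnj_poly G) < N" "degree F < N" "degree G < N"
    using N by (auto intro!: deg)
  have degp: "degree (pderiv p) < N" if "degree p < N" for p :: "complex poly"
    using dp[of p] that by simp
  have key: "cmod (\<Sum>m<N. (coeff (pderiv u * v) m * coeff (pderiv (F * G)) m) * of_real s ^ m)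
      \<le> (\<Sum>m<N. d m * s ^ m)" if s: "0 \<le> s" "s \<le> 1" for s
  proof -
    \<comment> \<open>Parseval produces \<open>r ^ (2 * m)\<close>, which has to equal
      \<open>s ^ m\<close>.\<close>
    define r where "r = sqrt s"
    have r: "0 \<le> r" "r \<le> 1" "r\<^sup>2 = s" using s by (auto simp: r_def)
    have rm: "r ^ (2 * m) = s ^ m" for m using r(3) by (simp add: power_mult)
    have crm: "complex_of_real r ^ (2 * m) = of_real s ^ m" for m
      by (simp only: rm flip: of_real_power)
    define z where "z = (\<lambda>m. complex_of_real r * w ^ m)"
    have z1: "cmod (z m) \<le> 1" for m using r by (simp add: z_def w_def norm_mult norm_power)
    have cz: "cnj (z m) = of_real r * cnj (w ^ m)" for m by (simp add: z_def)
    have avg: "(\<Sum>m<N. (cmod (poly (pderiv p) (z m)))\<^sup>2) = N * (\<Sum>m<N. sq p m * s ^ m)"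
      if "degree p < N" for p
      using sum_roots_poly_norm[OF degp[OF that], of r] by (simp add: z_def w_def sq_def rm)
    have cc: "cmod (poly p (cnj x)) = cmod (poly (cnj_poly p) x)" for p x
      using poly_cnj_poly[of p "cnj x"] by (metis complex_cnj_cnj complex_mod_cnj)
    have avgc: "(\<Sum>m<N. (cmod (poly (pderiv p) (cnj (z m))))\<^sup>2) = N * (\<Sum>m<N. sq p m * s ^ m)"
      if "degree p < N" for p
    proof -
      have "(\<Sum>m<N. (cmod (poly (pderiv p) (cnj (z m))))\<^sup>2)
          = (\<Sum>m<N. (cmod (poly (cnj_poly (pderiv p)) (z m)))\<^sup>2)" by (simp add: cc)
      also have "\<dots> = N * (\<Sum>m<N. (cmod (coeff (cnj_poly (pderiv p)) m))\<^sup>2 * r ^ (2 * m))"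
        unfolding z_def w_def by (rule sum_roots_poly_norm) (use degp[OF that] in simp)
      finally show ?thesis by (simp add: sq_def rm)
    qed
    have pt: "cmod (poly (pderiv u * v) (z m) * poly (pderiv (F * G)) (cnj (z m)))
      \<le> ((cmod (poly (pderiv F) (cnj (z m))))\<^sup>2 + (cmod (poly (pderiv G) (cnj (z m))))\<^sup>2) / 2
        + ((cmod (poly (pderiv (u * cnj_poly F)) (z m)))\<^sup>2 + (cmod (poly (pderiv (u * cnj_poly G)) (z m)))\<^sup>2)
        + ((cmod (poly (pderiv (cnj_poly F)) (z m)))\<^sup>2 + (cmod (poly (pderiv (cnj_poly G)) (z m)))\<^sup>2)"
      for m
    proof -
      let ?u = "cmod (poly (pderiv u) (z m))"
      have am: "x * y \<le> (x\<^sup>2 + y\<^sup>2) / 2" for x y :: real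
        using sum_squares_bound[of x y] by simp
      have "cmod (poly (pderiv u * v) (z m) * poly (pderiv (F * G)) (cnj (z m)))
          \<le> ?u * cmod (poly (pderiv (F * G)) (cnj (z m)))"
        using v[OF z1[of m]] by (simp add: norm_mult mult_left_le mult_right_mono)
      also have "\<dots> \<le> ?u * (cmod (poly F (cnj (z m))) * cmod (poly (pderiv G) (cnj (z m)))
          + cmod (poly G (cnj (z m))) * cmod (poly (pderiv F) (cnj (z m))))"
        by (intro mult_left_mono) (simp_all add: pderiv_mult norm_triangle_ineq flip: norm_mult)
      also have "\<dots> = cmod (poly (pderiv G) (cnj (z m))) * cmod (poly (pderiv u) (z m) * poly (cnj_poly F) (z m))
          + cmod (poly (pderiv F) (cnj (z m))) * cmod (poly (pderiv u) (z m) * poly (cnj_poly G) (z m))"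
        by (simp add: cc[of F] cc[of G] norm_mult algebra_simps)
      also have "\<dots> \<le> ((cmod (poly (pderiv G) (cnj (z m))))\<^sup>2 + (cmod (poly (pderiv u) (z m) * poly (cnj_poly F) (z m)))\<^sup>2) / 2
          + ((cmod (poly (pderiv F) (cnj (z m))))\<^sup>2 + (cmod (poly (pderiv u) (z m) * poly (cnj_poly G) (z m)))\<^sup>2) / 2"
        by (intro add_mono am)
      finally have "cmod (poly (pderiv u * v) (z m) * poly (pderiv (F * G)) (cnj (z m))) \<le> \<dots>" .
      moreover have "l \<le> (a + b) / 2 + (x + y) + (p + q)"
        if "l \<le> (b + c) / 2 + (a + d) / 2" "c \<le> 2 * x + 2 * p" "d \<le> 2 * y + 2 * q"
        for a b c d l p q x y :: real
        using that by (simp add: field_simps)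
      ultimately show ?thesis
        using norm_pderiv_mult_le[OF u[OF z1[of m]]] by blast
    qed
    have "N * cmod (\<Sum>m<N. (coeff (pderiv u * v) m * coeff (pderiv (F * G)) m) * of_real s ^ m)
        = cmod (\<Sum>m<N. poly (pderiv u * v) (z m) * poly (pderiv (F * G)) (cnj (z m)))"
    proof -
      have "(\<Sum>m<N. poly (pderiv u * v) (z m) * poly (pderiv (F * G)) (cnj (z m))) = 
        of_nat N * (\<Sum>m<N. (coeff (pderiv u * v) m * coeff (pderiv (F * G)) m) * of_real s ^ m)"
        unfolding cz unfolding z_def w_def crm [symmetric]
        by (rule sum_roots_poly_pairing; (rule degp)?; rule deg; use N dp[of u] in simp)
      then show ?thesis by (simp add: norm_mult)
    qed
    also have "\<dots> \<le> (\<Sum>m<N. ((cmod (poly (pderiv F) (cnj (z m))))\<^sup>2 + (cmod (poly (pderiv G) (cnj (z m))))\<^sup>2) / 2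
        + ((cmod (poly (pderiv (u * cnj_poly F)) (z m)))\<^sup>2 + (cmod (poly (pderiv (u * cnj_poly G)) (z m)))\<^sup>2)
        + ((cmod (poly (pderiv (cnj_poly F)) (z m)))\<^sup>2 + (cmod (poly (pderiv (cnj_poly G)) (z m)))\<^sup>2))"
      by (rule order_trans[OF norm_sum sum_mono]) (rule pt)
    also have "\<dots> = (N * (\<Sum>m<N. sq F m * s ^ m) + N * (\<Sum>m<N. sq G m * s ^ m)) / 2
       + (N * (\<Sum>m<N. sq (u * cnj_poly F) m * s ^ m) + N * (\<Sum>m<N. sq (u * cnj_poly G) m * s ^ m))
       + (N * (\<Sum>m<N. sq (cnj_poly F) m * s ^ m) + N * (\<Sum>m<N. sq (cnj_poly G) m * s ^ m))"
      by (simp only: sum.distrib sum_divide_distrib [symmetric] avg avgc degu degree_cnj_poly)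
    also have "\<dots> = N * (\<Sum>m<N. d m * s ^ m)"
      by (simp add: d_def sum.distrib algebra_simps add_divide_distrib sum_divide_distrib sum_distrib_left)
    finally show ?thesis using N0 by simp
  qed
  have "cmod (\<Sum>m<N. coeff (pderiv u * v) m * coeff (F * G) (Suc m) / of_nat (Suc m))
      = cmod (\<Sum>m<N. coeff (pderiv u * v) m * coeff (pderiv (F * G)) m / (of_nat (Suc m))\<^sup>2)"
    by (intro arg_cong[of _ _ cmod] sum.cong refl)
      (simp add: coeff_pderiv power2_eq_square del: of_nat_Suc)
  also have "\<dots> \<le> (\<Sum>m<N. d m / (real (Suc m))\<^sup>2)"
    by (rule norm_sum_div_Suc_square_le) (rule key)
  also have "\<dots> = ((\<Sum>m<N. sq F m / (real (Suc m))\<^sup>2) + (\<Sum>m<N. sq G m / (real (Suc m))\<^sup>2)) / 2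
      + ((\<Sum>m<N. sq (u * cnj_poly F) m / (real (Suc m))\<^sup>2) + (\<Sum>m<N. sq (u * cnj_poly G) m / (real (Suc m))\<^sup>2))
      + ((\<Sum>m<N. sq (cnj_poly F) m / (real (Suc m))\<^sup>2) + (\<Sum>m<N. sq (cnj_poly G) m / (real (Suc m))\<^sup>2))"
    unfolding d_def by (simp only: add_divide_distrib sum.distrib sum_divide_distrib divide_divide_eq_left mult.commute)
  also have "\<dots> \<le> 5 / 2 * ((\<Sum>i<N. (cmod (coeff F i))\<^sup>2) + (\<Sum>i<N. (cmod (coeff G i))\<^sup>2))"
  proof -
    have 1: "(\<Sum>m<N. sq p m / (real (Suc m))\<^sup>2) \<le> (\<Sum>i<N. (cmod (coeff p i))\<^sup>2)" if "degree p < N" for p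
      using sum_norm_coeff_pderiv[of p N] that by (simp add: sq_def coeff_eq_0)
    have 2: "(\<Sum>m<N. sq (u * cnj_poly p) m / (real (Suc m))\<^sup>2) \<le> (\<Sum>i<N. (cmod (coeff p i))\<^sup>2)"
      if "degree p < N" "degree (u * cnj_poly p) < N" for p
      using 1[OF that(2)] sum_norm_coeff_mult_le[OF u, of "cnj_poly p" N] that by simp
    have arith: "(a + b) / 2 + (c + d) + (e + f) \<le> 5 / 2 * (x + y)"
      if "a \<le> x" "b \<le> y" "c \<le> x" "d \<le> y" "e \<le> x" "f \<le> y" for a b c d e f x y :: real
      using that by (simp add: field_simps)
    show ?thesis
      by (rule arith[OF 1[OF degu(3)] 1[OF degu(4)] 2[OF degu(3) degu(1)] 2[OF degu(4) degu(2)]])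
        (use 1[of "cnj_poly F"] 1[of "cnj_poly G"] degu in simp_all)
  qed
  finally show ?thesis .
qed

text \<open>Homogeneity: once all four factors are normalized, both square sums are at most 1 and
  the weak bound becomes 5/2 * (1 + 1) = 5; multilinearity restores the product of the four
  bounds.\<close>

lemma paraproduct_bound:
  fixes u v F G :: "complex poly"
  assumes u: "\<And>z. cmod z \<le> 1 \<Longrightarrow> cmod (poly u z) \<le> U"
    and v: "\<And>z. cmod z \<le> 1 \<Longrightarrow> cmod (poly v z) \<le> V"
    and U: "0 < U" and V: "0 < V"
    and F: "(\<Sum>i<N. (cmod (coeff F i))\<^sup>2) \<le> A\<^sup>2" and G: "(\<Sum>i<N. (cmod (coeff G i))\<^sup>2) \<le> B\<^sup>2"
    and A: "0 < A" and B: "0 < B"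
    and N: "degree u + degree v + degree F + degree G < N"
  shows "cmod (\<Sum>m<N. coeff (pderiv u * v) m * coeff (F * G) (Suc m) / of_nat (Suc m))
    \<le> 5 * A * B * U * V"
proof -
  define u' v' F' G' where "u' = smult (of_real (1 / U)) u" and "v' = smult (of_real (1 / V)) v"
    and "F' = smult (of_real (1 / A)) F" and "G' = smult (of_real (1 / B)) G"
  have F': "(\<Sum>i<N. (cmod (coeff F' i))\<^sup>2) \<le> 1"
    using F A by (simp add: F'_def norm_mult norm_divide power_divide flip: sum_divide_distrib)
  have G': "(\<Sum>i<N. (cmod (coeff G' i))\<^sup>2) \<le> 1"
    using G B by (simp add: G'_def norm_mult norm_divide power_divide flip: sum_divide_distrib)
  have "cmod (\<Sum>m<N. coeff (pderiv u' * v') m * coeff (F' * G') (Suc m) / of_nat (Suc m))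
      \<le> 5 / 2 * ((\<Sum>i<N. (cmod (coeff F' i))\<^sup>2) + (\<Sum>i<N. (cmod (coeff G' i))\<^sup>2))"
  proof (rule paraproduct_bound_weak)
    show "cmod (poly u' z) \<le> 1" if "cmod z \<le> 1" for z
      using u[OF that] U by (simp add: u'_def norm_mult norm_divide)
    show "cmod (poly v' z) \<le> 1" if "cmod z \<le> 1" for z
      using v[OF that] V by (simp add: v'_def norm_mult norm_divide)
    show "degree u' + degree v' + degree F' + degree G' < N"
      using N U V A B by (simp add: u'_def v'_def F'_def G'_def)
  qed
  also have "\<dots> \<le> 5" using F' G' by simp
  finally have le: "cmod (\<Sum>m<N. coeff (pderiv u' * v') m * coeff (F' * G') (Suc m) / of_nat (Suc m)) \<le> 5" .
  have "(\<Sum>m<N. coeff (pderiv u' * v') m * coeff (F' * G') (Suc m) / of_nat (Suc m)) =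
    of_real (1 / (A * B * U * V)) * (\<Sum>m<N. coeff (pderiv u * v) m * coeff (F * G) (Suc m) / of_nat (Suc m))"
    by (simp add: u'_def v'_def F'_def G'_def pderiv_smult sum_distrib_left mult_ac)
  then have "cmod (\<Sum>m<N. coeff (pderiv u' * v') m * coeff (F' * G') (Suc m) / of_nat (Suc m)) =
    cmod (\<Sum>m<N. coeff (pderiv u * v) m * coeff (F * G) (Suc m) / of_nat (Suc m)) / (A * B * U * V)"
    using A B U V by (simp add: norm_mult norm_divide)
  then show ?thesis
    using le A B U V by (simp add: pos_divide_le_eq mult_ac)
qed



section \<open>Factorization of Hardy space functions\<close>

definition poly_of_seq :: "(nat \<Rightarrow> complex) \<Rightarrow> nat \<Rightarrow> complex poly"
  where "poly_of_seq f L = (\<Sum>i<L. monom (f i) i)"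

lemma coeff_poly_of_seq [simp]: "coeff (poly_of_seq f L) n = (if n < L then f n else 0)"
proof -
  have "coeff (poly_of_seq f L) n = (\<Sum>i<L. if i = n then f i else 0)"
    by (simp add: poly_of_seq_def coeff_sum)
  then show ?thesis by (simp add: sum.delta')
qed

lemma degree_poly_of_seq: "0 < L \<Longrightarrow> degree (poly_of_seq f L) < L"
  by (intro degree_lessI) auto

lemma poly_poly_of_seq: "poly (poly_of_seq f L) z = (\<Sum>i<L. f i * z ^ i)"
  by (simp add: poly_of_seq_def poly_sum poly_monom)

lemma power_series_tail_bound:
  fixes f :: "nat \<Rightarrow> complex"
  assumes "summable (\<lambda>n. cmod (f n))" "cmod z \<le> 1" "(\<lambda>n. f n * z ^ n) sums s"
  shows "cmod (s - poly (poly_of_seq f L) z) \<le> (\<Sum>n. cmod (f (n + L)))"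
proof -
  have sm: "summable (\<lambda>n. cmod (f (n + L)))" using assms(1) by (rule summable_ignore_initial_segment)
  have "(\<lambda>n. f (n + L) * z ^ (n + L)) sums (s - poly (poly_of_seq f L) z)"
    using sums_split_initial_segment[OF assms(3), of L] by (simp add: poly_poly_of_seq)
  then have "s - poly (poly_of_seq f L) z = (\<Sum>n. f (n + L) * z ^ (n + L))" by (simp add: sums_iff)
  also have "cmod \<dots> \<le> (\<Sum>n. cmod (f (n + L)))"
  proof (rule norm_suminf_le[OF _ sm])
    show "cmod (f (n + L) * z ^ (n + L)) \<le> cmod (f (n + L))" for n
      using assms(2) by (simp add: norm_mult norm_power mult_left_le power_le_one)
  qed
  finally show ?thesis .
qed

text \<open>Parseval is exact only for polynomials of degree below \<open>N\<close>, so
  \<open>F\<close> is replaced on the circle by its truncation at \<open>L\<close>, with uniform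
  error \<open>\<delta> L\<close>. For each \<open>L\<close> the hypothesis \<open>M\<close> is used
  at one \<open>N \<ge> L\<close>; then \<open>L\<close> tends to infinity.\<close>

lemma bessel_roots_of_unity:
  fixes f :: "nat \<Rightarrow> complex"
  assumes sm: "summable (\<lambda>n. cmod (f n))"
    and F: "\<And>z. cmod z = 1 \<Longrightarrow> (\<lambda>n. f n * z ^ n) sums F z"
    and M: "\<forall>\<^sub>F N in sequentially. (\<Sum>m<N. (cmod (F (cis (2 * pi / real N) ^ m)))\<^sup>2) \<le> real N * M"
  shows "(\<Sum>i<K. (cmod (f i))\<^sup>2) \<le> M"
proof -
  define S where "S = (\<Sum>n. cmod (f n))"
  define \<delta> where "\<delta> = (\<lambda>L. \<Sum>n. cmod (f (n + L)))"
  have \<delta>: "\<delta> \<longlonglongrightarrow> 0" unfolding \<delta>_def by (rule suminf_exist_split2[OF sm])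
  have \<delta>0: "0 \<le> \<delta> L" for L
    unfolding \<delta>_def using sm by (intro suminf_nonneg summable_ignore_initial_segment) auto
  have tail: "cmod (F z - poly (poly_of_seq f L) z) \<le> \<delta> L" if "cmod z = 1" for z L
    unfolding \<delta>_def using power_series_tail_bound[OF sm _ F[OF that]] that by simp
  have FS: "cmod (F z) \<le> S" if "cmod z = 1" for z
    using tail[OF that, of 0] by (simp add: \<delta>_def S_def poly_of_seq_def)
  have le: "(\<Sum>i<K. (cmod (f i))\<^sup>2) \<le> M + \<delta> L * (2 * S + \<delta> L)" if L: "L \<ge> Suc K" for L
  proof -
    obtain N where N: "N \<ge> L" "(\<Sum>m<N. (cmod (F (cis (2 * pi / real N) ^ m)))\<^sup>2) \<le> real N * M"
      using eventually_happens[OF eventually_conj[OF M eventually_ge_at_top[of L]]] by auto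
    let ?w = "cis (2 * pi / real N)" and ?p = "poly_of_seq f L"
    have N0: "N > 0" using N L by simp
    have "real N * (\<Sum>i<K. (cmod (f i))\<^sup>2) = real N * (\<Sum>i<K. (cmod (coeff ?p i))\<^sup>2)"
      using L by simp
    also have "\<dots> \<le> real N * (\<Sum>i<N. (cmod (coeff ?p i))\<^sup>2)"
      using L N by (intro mult_left_mono sum_mono2) auto
    also have "\<dots> = (\<Sum>m<N. (cmod (poly ?p (?w ^ m)))\<^sup>2)"
      using sum_roots_poly_norm[of ?p N 1] degree_poly_of_seq[of L f] L N by simp
    also have "\<dots> \<le> (\<Sum>m<N. (cmod (F (?w ^ m)))\<^sup>2 + \<delta> L * (2 * S + \<delta> L))"
    proof (rule sum_mono)
      fix m
      have w1: "cmod (?w ^ m) = 1" by (simp add: norm_power)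
      have "cmod (poly ?p (?w ^ m)) \<le> cmod (F (?w ^ m)) + \<delta> L"
        using tail[OF w1, of L] norm_triangle_ineq2[of "poly ?p (?w ^ m)" "F (?w ^ m)"]
        by (simp add: norm_minus_commute)
      then have "(cmod (poly ?p (?w ^ m)))\<^sup>2 \<le> (cmod (F (?w ^ m)) + \<delta> L)\<^sup>2"
        by (simp add: power_mono)
      also have "\<dots> = (cmod (F (?w ^ m)))\<^sup>2 + \<delta> L * (2 * cmod (F (?w ^ m)) + \<delta> L)"
        by (simp add: power2_eq_square algebra_simps)
      also have "\<dots> \<le> (cmod (F (?w ^ m)))\<^sup>2 + \<delta> L * (2 * S + \<delta> L)"
        using FS[OF w1] \<delta>0[of L] by (intro add_left_mono mult_left_mono) auto
      finally show "(cmod (poly ?p (?w ^ m)))\<^sup>2 \<le> \<dots>" .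
    qed
    also have "\<dots> \<le> real N * (M + \<delta> L * (2 * S + \<delta> L))"
      using N(2) by (simp add: sum.distrib algebra_simps)
    finally show ?thesis using N0 by simp
  qed
  have "(\<lambda>L. M + \<delta> L * (2 * S + \<delta> L)) \<longlonglongrightarrow> M + 0 * (2 * S + 0)"
    by (intro tendsto_intros \<delta>)
  then show ?thesis using LIMSEQ_le_const[of "\<lambda>L. M + \<delta> L * (2 * S + \<delta> L)" M] le by auto
qed

text \<open>A zero \<open>\<alpha>\<close> inside the disc is reflected to \<open>1 / cnj \<alpha>\<close>; thus \<open>B / C\<close> is a Blaschke product.\<close>
lemma poly_blaschke_factorization:
  fixes P :: "complex poly"
  assumes "\<And>z. cmod z = 1 \<Longrightarrow> poly P z \<noteq> 0"
  shows "\<exists>Q B C. P * C = Q * B \<and> (\<forall>z. cmod z = 1 \<longrightarrow> cmod (poly B z) = cmod (poly C z)) \<and>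
    (\<forall>z. cmod z \<le> 1 \<longrightarrow> poly Q z \<noteq> 0 \<and> poly C z \<noteq> 0)"
  using assms
proof (induction "degree P" arbitrary: P)
  case 0
  then obtain c where c: "P = [:c:]" by (auto elim: degree_eq_zeroE)
  have "c \<noteq> 0" using 0(2)[of 1] c by simp
  then show ?case using c by (intro exI[of _ P] exI[of _ 1]) auto
next
  case (Suc n)
  have "coeff P 0 = 0 \<or> (\<exists>i\<in>{1..degree P}. coeff P i \<noteq> 0)"
    using Suc(2) by (intro disjI2 bexI[of _ "degree P"]) auto
  then obtain \<alpha> where \<alpha>: "poly P \<alpha> = 0"
    using fundamental_theorem_of_algebra[of "coeff P" "degree P"] by (auto simp: poly_altdef)
  then obtain P' where P': "P = [:- \<alpha>, 1:] * P'" by (metis dvdE poly_eq_0_iff_dvd)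
  have P'0: "P' \<noteq> 0" using Suc(2) P' by auto
  have "degree P = degree [:- \<alpha>, 1:] + degree P'"
    unfolding P' by (rule degree_mult_eq) (use P'0 in auto)
  then have "n = degree P'" using Suc(2) by simp
  moreover have "poly P' z \<noteq> 0" if "cmod z = 1" for z
    using Suc(3)[OF that] P' by auto
  ultimately obtain Q B C where QBC: "P' * C = Q * B"
    "\<And>z. cmod z = 1 \<Longrightarrow> cmod (poly B z) = cmod (poly C z)"
    "\<And>z. cmod z \<le> 1 \<Longrightarrow> poly Q z \<noteq> 0 \<and> poly C z \<noteq> 0"
    using Suc(1)[of P'] by blast
  have ne: "cmod \<alpha> \<noteq> 1" using \<alpha> Suc(3) by blast
  show ?case
  \<comment> \<open>A root outside the closed disc may stay in \<open>Q\<close>. A root inside goes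
    to \<open>B\<close>, and its reflection contributes the same factor to \<open>C\<close> and to
    \<open>Q\<close>.\<close>
  proof (cases "cmod \<alpha> > 1")
    case True
    show ?thesis
    proof (intro exI conjI allI impI)
      show "P * C = ([:- \<alpha>, 1:] * Q) * B" using QBC(1) P' by (metis mult.assoc)
      show "cmod (poly B z) = cmod (poly C z)" if "cmod z = 1" for z using QBC(2)[OF that] .
      show "poly ([:- \<alpha>, 1:] * Q) z \<noteq> 0" "poly C z \<noteq> 0" if "cmod z \<le> 1" for z
        using QBC(3)[OF that] True that by auto
    qed
  next
    case False
    then have a: "cmod \<alpha> < 1" using ne by simp
    let ?C = "[:1, - cnj \<alpha>:]"
    have C: "poly ?C z \<noteq> 0" if "cmod z \<le> 1" for z
    proof
      assume "poly ?C z = 0"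
      then have "cnj \<alpha> * z = 1" by (simp add: mult.commute)
      then have "cmod \<alpha> * cmod z = 1" by (metis norm_mult norm_one complex_mod_cnj)
      moreover have "cmod \<alpha> * cmod z \<le> cmod \<alpha>" using that by (simp add: mult_left_le)
      ultimately show False using a by simp
    qed
    show ?thesis
    proof (intro exI conjI allI impI)
      show "P * (?C * C) = (?C * Q) * ([:- \<alpha>, 1:] * B)"
      proof -
        have "P * (?C * C) = ?C * [:- \<alpha>, 1:] * (P' * C)" unfolding P' by (simp only: mult_ac)
        then show ?thesis unfolding QBC(1) by (simp only: mult_ac)
      qed
      show "cmod (poly ([:- \<alpha>, 1:] * B) z) = cmod (poly (?C * C) z)" if "cmod z = 1" for z
      proof -
        have "z * cnj z = 1" using that by (simp add: complex_norm_square [symmetric])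
        then have "z - \<alpha> = z * cnj (1 - cnj \<alpha> * z)" by (simp add: algebra_simps)
        then have "cmod (z - \<alpha>) = cmod (1 - cnj \<alpha> * z)"
          using that by (metis complex_mod_cnj mult_1 norm_mult)
        moreover have "poly ([:- \<alpha>, 1:] * B) z = (z - \<alpha>) * poly B z"
          "poly (?C * C) z = (1 - cnj \<alpha> * z) * poly C z"
          by (simp_all add: algebra_simps)
        ultimately show ?thesis using QBC(2)[OF that] by (simp only: norm_mult)
      qed
      show "poly (?C * Q) z \<noteq> 0" "poly (?C * C) z \<noteq> 0" if "cmod z \<le> 1" for z
        using QBC(3)[OF that] C[OF that] by auto
    qed
  qed
qed

text \<open>Room beyond the unit circle makes the Taylor coefficients of both factors in the later
  factorization absolutely summable. It exists because the roots are finite in number and lie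
  outside the closed disc.\<close>

lemma poly_nonzero_larger_disc:
  fixes Q :: "complex poly"
  assumes "\<And>z. cmod z \<le> 1 \<Longrightarrow> poly Q z \<noteq> 0"
  obtains R where "1 < R" "\<And>z. cmod z < R \<Longrightarrow> poly Q z \<noteq> 0"
proof -
  have "Q \<noteq> 0" using assms[of 0] by auto
  \<comment> \<open>The element 2 keeps the set nonempty when \<open>Q\<close> has no roots.\<close>
  then have fin: "finite (insert 2 (cmod ` {z. poly Q z = 0}))" by (simp add: poly_roots_finite)
  define R where "R = Min (insert 2 (cmod ` {z. poly Q z = 0}))"
  have "R > 1" unfolding R_def using fin assms by (subst Min_gr_iff) (auto simp: not_le [symmetric])
  moreover have "poly Q z \<noteq> 0" if "cmod z < R" for z
  proof
    assume "poly Q z = 0"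
    then have "R \<le> cmod z" unfolding R_def using fin by (intro Min_le) auto
    then show False using that by simp
  qed
  ultimately show ?thesis using that by blast
qed

section \<open>Factorization into two H^2 functions, for polynomials and in the limit\<close>

lemma has_fps_expansion_summable_norm:
  fixes F :: "complex fps"
  assumes "f has_fps_expansion F" "f holomorphic_on ball 0 R" "1 < R"
  shows "summable (\<lambda>n. cmod (fps_nth F n))"
    and "cmod z \<le> 1 \<Longrightarrow> (\<lambda>n. fps_nth F n * z ^ n) sums f z"
proof -
  have h: "f holomorphic_on eball 0 (ereal R)" using assms(2) by simp
  have "fps_conv_radius F \<ge> ereal R" by (rule holomorphic_on_imp_fps_conv_radius_ge[OF assms(1) h])
  moreover have "1 < ereal R" using assms(3) by (simp add: one_ereal_def)
  ultimately have "1 < conv_radius (fps_nth F)"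
    unfolding fps_conv_radius_def by (rule order.strict_trans2 [rotated])
  then show "summable (\<lambda>n. cmod (fps_nth F n))"
    using abs_summable_in_conv_radius[of 1 "fps_nth F"] by (simp add: one_ereal_def)
  show "(\<lambda>n. fps_nth F n * z ^ n) sums f z" if "cmod z \<le> 1"
    by (rule has_fps_expansion_imp_sums_complex[OF assms(1) h]) (use that assms(3) in auto)
qed

text \<open>The classical factorization of F. Riesz. \<open>Q\<close> has no zeros on a disc larger
  than the unit disc, so it has a holomorphic square root \<open>F\<close> there, and
  \<open>G\<close> is \<open>F\<close> times the Blaschke product \<open>B / C\<close>, of modulus 1
  on the circle. Hence \<open>F\<close> and \<open>G\<close> both have squared modulus
  \<open>cmod (poly P z)\<close> on the circle, and the mean of that modulus bounds both square
  sums.\<close>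

lemma poly_hardy_factorization:
  fixes P :: "complex poly"
  assumes nz: "\<And>z. cmod z = 1 \<Longrightarrow> poly P z \<noteq> 0"
    and M: "\<forall>\<^sub>F N in sequentially. (\<Sum>m<N. cmod (poly P (cis (2 * pi / real N) ^ m))) \<le> real N * M"
  shows "\<exists>f g. (\<forall>n. coeff P n = (\<Sum>i\<le>n. f i * g (n - i))) \<and>
    (\<forall>K. (\<Sum>i<K. (cmod (f i))\<^sup>2) \<le> M) \<and> (\<forall>K. (\<Sum>i<K. (cmod (g i))\<^sup>2) \<le> M)"
proof -
  obtain Q B C where QBC: "P * C = Q * B"
    "\<And>z. cmod z = 1 \<Longrightarrow> cmod (poly B z) = cmod (poly C z)"
    "\<And>z. cmod z \<le> 1 \<Longrightarrow> poly Q z \<noteq> 0 \<and> poly C z \<noteq> 0"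
    using poly_blaschke_factorization[OF nz] by blast
  obtain R where R: "1 < R" "\<And>z. cmod z < R \<Longrightarrow> poly (Q * C) z \<noteq> 0"
    using poly_nonzero_larger_disc[of "Q * C"] QBC(3) by auto
  obtain F where F: "F holomorphic_on ball 0 R" "\<And>z. z \<in> ball 0 R \<Longrightarrow> poly Q z = F z ^ 2"
    by (rule simply_connected_imp_holomorphic_sqrt[of "poly Q" "ball 0 R"])
      (use R in \<open>auto intro!: convex_imp_simply_connected convex_imp_locally_path_connected holomorphic_intros\<close>)
  define G where "G = (\<lambda>z. F z * poly B z / poly C z)"
  have G: "G holomorphic_on ball 0 R"
    unfolding G_def using R(2) by (intro holomorphic_intros F) auto
  have PFG: "poly P z = F z * G z" if "z \<in> ball 0 R" for z
  proof -
    have "poly P z * poly C z = poly Q z * poly B z" using QBC(1) by (metis poly_mult)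
    moreover have "poly C z \<noteq> 0" using R(2)[of z] that by auto
    ultimately show ?thesis using F(2)[OF that] by (simp add: G_def field_simps power2_eq_square)
  qed
  have circ: "(cmod (F z))\<^sup>2 = cmod (poly P z)" "(cmod (G z))\<^sup>2 = cmod (poly P z)" if "cmod z = 1" for z
  proof -
    have zR: "z \<in> ball 0 R" using that R by simp
    have C0: "cmod (poly C z) \<noteq> 0" using QBC(3)[of z] that by simp
    have GF: "cmod (G z) = cmod (F z)"
      using QBC(2)[OF that] C0 by (simp add: G_def norm_mult norm_divide)
    show "(cmod (F z))\<^sup>2 = cmod (poly P z)"
      using PFG[OF zR] GF by (simp add: norm_mult power2_eq_square)
    then show "(cmod (G z))\<^sup>2 = cmod (poly P z)" using GF by simp
  qed
  define f g where "f = fps_expansion F 0" and "g = fps_expansion G 0"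
  have fe: "F has_fps_expansion f" "G has_fps_expansion g"
    unfolding f_def g_def using F(1) G R by (auto intro!: has_fps_expansion_fps_expansion[of "ball 0 R"])
  have "poly P has_fps_expansion fps_of_poly P"
    unfolding has_fps_expansion_def by simp
  moreover have "poly P has_fps_expansion f * g"
  proof -
    have "(\<lambda>z. F z * G z) has_fps_expansion f * g" using fe by (rule has_fps_expansion_mult)
    moreover have "\<forall>\<^sub>F z in nhds 0. F z * G z = poly P z"
      by (rule eventually_nhds_in_open[of "ball 0 R", THEN eventually_mono])
        (use R PFG in auto)
    ultimately show ?thesis by (subst (asm) has_fps_expansion_cong) auto
  qed
  ultimately have fg: "fps_of_poly P = f * g" by (rule fps_expansion_unique_complex)
  show ?thesis
  proof (intro exI conjI allI)
    show "coeff P n = (\<Sum>i\<le>n. fps_nth f i * fps_nth g (n - i))" for n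
      using arg_cong[OF fg, of "\<lambda>x. fps_nth x n"] by (simp add: fps_mult_nth atLeast0AtMost)
    have c1: "cmod (cis t ^ m) = 1" for t m by (simp add: norm_power)
    show "(\<Sum>i<K. (cmod (fps_nth f i))\<^sup>2) \<le> M" for K
      by (rule bessel_roots_of_unity[of _ F])
        (use has_fps_expansion_summable_norm[OF fe(1) F(1) R(1)] M in \<open>auto simp: circ c1\<close>)
    show "(\<Sum>i<K. (cmod (fps_nth g i))\<^sup>2) \<le> M" for K
      by (rule bessel_roots_of_unity[of _ G])
        (use has_fps_expansion_summable_norm[OF fe(2) G R(1)] M in \<open>auto simp: circ c1\<close>)
  qed
qed

text \<open>Dilation by \<open>\<rho>\<close> makes the series absolutely summable and truncation
  makes it a polynomial. The tail has size below 1 on the circle, which is the 1 in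
  \<open>M + 1\<close>. The truncation order is at least \<open>j\<close>, so the first
  \<open>j\<close> coefficients are exact.\<close>

lemma hardy_factorization_approx:
  fixes a :: "nat \<Rightarrow> complex"
  assumes C: "\<And>n. cmod (a n) \<le> C"
    and H: "\<And>c. cmod c < 1 \<Longrightarrow> (\<lambda>n. a n * c ^ n) sums H c"
    and M: "\<And>r. \<lbrakk>0 < r; r < 1\<rbrakk> \<Longrightarrow>
      \<forall>\<^sub>F N in sequentially. (\<Sum>m<N. cmod (H (of_real r * cis (2 * pi / real N) ^ m))) \<le> real N * M"
    and a: "a n0 \<noteq> 0" and s: "0 \<le> s" "s < 1"
  shows "\<exists>\<rho> f g. s < \<rho> \<and> \<rho> < 1 \<and> (\<forall>n<j. a n * of_real \<rho> ^ n = (\<Sum>i\<le>n. f i * g (n - i))) \<and>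
    (\<forall>K. (\<Sum>i<K. (cmod (f i))\<^sup>2) \<le> M + 1) \<and> (\<forall>K. (\<Sum>i<K. (cmod (g i))\<^sup>2) \<le> M + 1)"
proof -
  \<comment> \<open>The tail is made small at radius \<open>t\<close>, hence for every smaller
    \<open>\<rho>\<close>. The polynomial \<open>P\<close> is thus fixed before
    \<open>\<rho>\<close>, which can then avoid the finitely many moduli of its roots; the
    coefficient at \<open>n0\<close> ensures that \<open>P\<close> is nonzero.\<close>
  define t where "t = (s + 1) / 2"
  have t: "s < t" "t < 1" "0 < t" using s by (auto simp: t_def)
  have sm: "summable (\<lambda>n. cmod (a n * of_real \<rho> ^ n))" if "0 \<le> \<rho>" "\<rho> < 1" for \<rho>
  proof (rule summable_comparison_test'[of "\<lambda>n. C * \<rho> ^ n"])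
    show "summable (\<lambda>n. C * \<rho> ^ n)" using that by (intro summable_mult summable_geometric) auto
    show "norm (cmod (a n * of_real \<rho> ^ n)) \<le> C * \<rho> ^ n" for n
      using that C[of n] by (simp add: norm_mult norm_power mult_right_mono)
  qed
  have "(\<lambda>L. \<Sum>n. cmod (a (n + L) * of_real t ^ (n + L))) \<longlonglongrightarrow> 0"
    using suminf_exist_split2[OF sm[of t]] t by simp
  then have "\<forall>\<^sub>F L in sequentially. (\<Sum>n. cmod (a (n + L) * of_real t ^ (n + L))) < 1"
    by (rule order_tendstoD) simp
  then have "\<forall>\<^sub>F L in sequentially. (\<Sum>n. cmod (a (n + L) * of_real t ^ (n + L))) < 1
      \<and> L \<ge> Suc n0 \<and> L \<ge> j"
    by (intro eventually_conj eventually_ge_at_top)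
  then obtain L where L: "(\<Sum>n. cmod (a (n + L) * of_real t ^ (n + L))) < 1" "Suc n0 \<le> L" "j \<le> L"
    using eventually_happens'[OF sequentially_bot] by blast
  define P where "P = poly_of_seq a L"
  have "coeff P n0 \<noteq> 0" using a L(2) by (simp add: P_def)
  then have "P \<noteq> 0" by auto
  then have "finite (cmod ` {z. poly P z = 0})" by (simp add: poly_roots_finite)
  then have "\<not> {s<..<t} \<subseteq> cmod ` {z. poly P z = 0}"
    using infinite_Ioo[OF t(1)] finite_subset by blast
  then obtain \<rho> where "\<rho> \<in> {s<..<t}" and nr: "\<rho> \<notin> cmod ` {z. poly P z = 0}"
    by blast
  then have \<rho>: "s < \<rho>" "\<rho> < t" by auto
  have \<rho>01: "0 < \<rho>" "\<rho> < 1" using \<rho> t s by auto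
  define P' where "P' = poly_of_seq (\<lambda>n. a n * of_real \<rho> ^ n) L"
  have P': "poly P' z = poly P (of_real \<rho> * z)" for z
    by (simp add: P'_def P_def poly_poly_of_seq power_mult_distrib mult_ac)
  have "\<exists>f g. (\<forall>n. coeff P' n = (\<Sum>i\<le>n. f i * g (n - i))) \<and>
    (\<forall>K. (\<Sum>i<K. (cmod (f i))\<^sup>2) \<le> M + 1) \<and> (\<forall>K. (\<Sum>i<K. (cmod (g i))\<^sup>2) \<le> M + 1)"
  proof (rule poly_hardy_factorization)
    show "poly P' z \<noteq> 0" if "cmod z = 1" for z
    proof
      assume "poly P' z = 0"
      then have "cmod (of_real \<rho> * z) \<in> cmod ` {z. poly P z = 0}" using P' by auto
      then show False using nr that \<rho>01 by (simp add: norm_mult)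
    qed
    have near: "cmod (poly P' z) \<le> cmod (H (of_real \<rho> * z)) + 1" if z: "cmod z = 1" for z
    proof -
      have sums: "(\<lambda>n. (a n * of_real \<rho> ^ n) * z ^ n) sums H (of_real \<rho> * z)"
        using H[of "of_real \<rho> * z"] z \<rho>01 by (simp add: norm_mult power_mult_distrib mult.assoc)
      have "cmod (H (of_real \<rho> * z) - poly P' z) \<le> (\<Sum>n. cmod (a (n + L) * of_real \<rho> ^ (n + L)))"
        unfolding P'_def
        by (rule power_series_tail_bound[OF sm _ sums]) (use z \<rho>01 in auto)
      also have "\<dots> \<le> (\<Sum>n. cmod (a (n + L) * of_real t ^ (n + L)))"
      proof (rule suminf_le)
        show "cmod (a (n + L) * of_real \<rho> ^ (n + L)) \<le> cmod (a (n + L) * of_real t ^ (n + L))" for n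
          using \<rho> \<rho>01 by (auto simp: norm_mult norm_power intro!: mult_left_mono power_mono)
      qed (use sm[of \<rho>] sm[of t] \<rho>01 t in \<open>auto intro: summable_ignore_initial_segment\<close>)
      finally show ?thesis
        using L(1) norm_triangle_ineq2[of "poly P' z" "H (of_real \<rho> * z)"]
        by (simp add: norm_minus_commute)
    qed
    show "\<forall>\<^sub>F N in sequentially. (\<Sum>m<N. cmod (poly P' (cis (2 * pi / real N) ^ m))) \<le> real N * (M + 1)"
      using M[OF \<rho>01]
    proof eventually_elim
      case (elim N)
      have "(\<Sum>m<N. cmod (poly P' (cis (2 * pi / real N) ^ m)))
          \<le> (\<Sum>m<N. cmod (H (of_real \<rho> * cis (2 * pi / real N) ^ m)) + 1)"
        by (intro sum_mono near) (simp add: norm_power)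
      then show ?case using elim by (simp add: sum.distrib algebra_simps)
    qed
  qed
  then obtain f g where fg: "\<And>n. coeff P' n = (\<Sum>i\<le>n. f i * g (n - i))"
    "\<And>K. (\<Sum>i<K. (cmod (f i))\<^sup>2) \<le> M + 1" "\<And>K. (\<Sum>i<K. (cmod (g i))\<^sup>2) \<le> M + 1"
    by blast
  have "a n * of_real \<rho> ^ n = (\<Sum>i\<le>n. f i * g (n - i))" if "n < j" for n
    using fg(1)[of n] that L(3) by (simp add: P'_def)
  then show ?thesis using fg(2,3) \<rho>(1) \<rho>01(2) by blast
qed

text \<open>A diagonal subsequence of the approximate factors converges coefficientwise. Each
  convolution and each partial square sum involves finitely many coefficients, so the identities and
  the bounds pass to the limit.\<close>

lemma hardy_factorization:
  fixes a :: "nat \<Rightarrow> complex"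
  assumes C: "\<And>n. cmod (a n) \<le> C"
    and H: "\<And>c. cmod c < 1 \<Longrightarrow> (\<lambda>n. a n * c ^ n) sums H c"
    and M: "\<And>r. \<lbrakk>0 < r; r < 1\<rbrakk> \<Longrightarrow>
      \<forall>\<^sub>F N in sequentially. (\<Sum>m<N. cmod (H (of_real r * cis (2 * pi / real N) ^ m))) \<le> real N * M"
    and M0: "0 \<le> M"
  obtains f g where "\<And>n. a n = (\<Sum>i\<le>n. f i * g (n - i))"
    "\<And>K. (\<Sum>i<K. (cmod (f i))\<^sup>2) \<le> M + 1" "\<And>K. (\<Sum>i<K. (cmod (g i))\<^sup>2) \<le> M + 1"
proof (cases "\<forall>n. a n = 0")
  case True
  then show ?thesis using M0 by (intro that[of "\<lambda>_. 0" "\<lambda>_. 0"]) auto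
next
  case False
  then obtain n0 where n0: "a n0 \<noteq> 0" by blast
  \<comment> \<open>Since \<open>\<rho> j\<close> lies between \<open>s j\<close> and 1, the
    dilation disappears in the limit.\<close>
  define s where "s = (\<lambda>j. 1 - inverse (real (Suc j)))"
  have s: "0 \<le> s j" "s j < 1" for j by (auto simp: s_def inverse_eq_divide)
  have "\<forall>j. \<exists>\<rho> f g. s j < \<rho> \<and> \<rho> < 1 \<and> (\<forall>n<j. a n * of_real \<rho> ^ n = (\<Sum>i\<le>n. f i * g (n - i))) \<and>
    (\<forall>K. (\<Sum>i<K. (cmod (f i))\<^sup>2) \<le> M + 1) \<and> (\<forall>K. (\<Sum>i<K. (cmod (g i))\<^sup>2) \<le> M + 1)"
    by (rule allI, rule hardy_factorization_approx[where a = a and H = H and C = C, OF _ _ M n0 s])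
      (simp_all add: C H)
  from choice[OF this] obtain \<rho> where "\<forall>j. \<exists>f g. s j < \<rho> j \<and> \<rho> j < 1 \<and>
    (\<forall>n<j. a n * of_real (\<rho> j) ^ n = (\<Sum>i\<le>n. f i * g (n - i))) \<and>
    (\<forall>K. (\<Sum>i<K. (cmod (f i))\<^sup>2) \<le> M + 1) \<and> (\<forall>K. (\<Sum>i<K. (cmod (g i))\<^sup>2) \<le> M + 1)" ..
  from choice[OF this] obtain F where "\<forall>j. \<exists>g. s j < \<rho> j \<and> \<rho> j < 1 \<and>
    (\<forall>n<j. a n * of_real (\<rho> j) ^ n = (\<Sum>i\<le>n. F j i * g (n - i))) \<and>
    (\<forall>K. (\<Sum>i<K. (cmod (F j i))\<^sup>2) \<le> M + 1) \<and> (\<forall>K. (\<Sum>i<K. (cmod (g i))\<^sup>2) \<le> M + 1)" ..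
  from choice[OF this] obtain G where **: "\<forall>j. s j < \<rho> j \<and> \<rho> j < 1 \<and>
    (\<forall>n<j. a n * of_real (\<rho> j) ^ n = (\<Sum>i\<le>n. F j i * G j (n - i))) \<and>
    (\<forall>K. (\<Sum>i<K. (cmod (F j i))\<^sup>2) \<le> M + 1) \<and> (\<forall>K. (\<Sum>i<K. (cmod (G j i))\<^sup>2) \<le> M + 1)" ..
  then have *: "\<And>j. s j < \<rho> j" "\<And>j. \<rho> j < 1"
    "\<And>j n. n < j \<Longrightarrow> a n * of_real (\<rho> j) ^ n = (\<Sum>i\<le>n. F j i * G j (n - i))"
    "\<And>j K. (\<Sum>i<K. (cmod (F j i))\<^sup>2) \<le> M + 1" "\<And>j K. (\<Sum>i<K. (cmod (G j i))\<^sup>2) \<le> M + 1"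
    by simp_all
  have bd: "cmod (f n) \<le> M + 1" if "\<And>K. (\<Sum>i<K. (cmod (f i))\<^sup>2) \<le> M + 1" for f :: "nat \<Rightarrow> complex" and n
  proof -
    have "(cmod (f n))\<^sup>2 \<le> (\<Sum>i<Suc n. (cmod (f i))\<^sup>2)" by (rule member_le_sum) auto
    also have "\<dots> \<le> M + 1" by (rule that)
    also have "\<dots> \<le> (M + 1)\<^sup>2" using M0 by (simp add: power2_eq_square algebra_simps)
    finally show ?thesis by (rule power2_le_imp_le) (use M0 in simp)
  qed
  obtain k where k: "strict_mono (k :: nat \<Rightarrow> nat)" "\<And>n. \<exists>l. (\<lambda>j. (F (k j) n, G (k j) n)) \<longlonglongrightarrow> l"
  proof (rule function_convergent_subsequence[of UNIV "\<lambda>j n. (F j n, G j n)" "2 * (M + 1)"])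
    show "norm (F j n, G j n) \<le> 2 * (M + 1)" for j n
      using norm_Pair_le[of "F j n" "G j n"] bd[OF *(4), of j n] bd[OF *(5), of j n] by simp
    fix k :: "nat \<Rightarrow> nat"
    assume "strict_mono k" "\<And>n. n \<in> UNIV \<Longrightarrow> \<exists>l. (\<lambda>j. (F (k j) n, G (k j) n)) \<longlonglongrightarrow> l"
    then show thesis by (intro that) blast+
  qed simp
  have "\<forall>n. \<exists>l. (\<lambda>j. (F (k j) n, G (k j) n)) \<longlonglongrightarrow> l" using k(2) ..
  from choice[OF this] obtain l where "\<forall>n. (\<lambda>j. (F (k j) n, G (k j) n)) \<longlonglongrightarrow> l n" ..
  then have l: "\<And>n. (\<lambda>j. (F (k j) n, G (k j) n)) \<longlonglongrightarrow> l n" ..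
  define f g where "f = (\<lambda>n. fst (l n))" and "g = (\<lambda>n. snd (l n))"
  have f: "(\<lambda>j. F (k j) n) \<longlonglongrightarrow> f n" and g: "(\<lambda>j. G (k j) n) \<longlonglongrightarrow> g n" for n
    using tendsto_fst[OF l[of n]] tendsto_snd[OF l[of n]] by (simp_all add: f_def g_def)
  have "s \<longlonglongrightarrow> 1 - 0" unfolding s_def by (intro tendsto_intros LIMSEQ_inverse_real_of_nat)
  then have "\<rho> \<longlonglongrightarrow> 1"
    by (intro tendsto_sandwich[of s \<rho> sequentially "\<lambda>_. 1" 1] always_eventually allI)
      (use *(1,2) in \<open>auto intro: less_imp_le\<close>)
  then have \<rho>: "(\<lambda>j. \<rho> (k j)) \<longlonglongrightarrow> 1" using k(1) by (simp add: LIMSEQ_subseq_LIMSEQ [unfolded o_def])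
  show ?thesis
  proof (rule that[of f g])
    fix n
    have "(\<lambda>j. a n * of_real (\<rho> (k j)) ^ n) \<longlonglongrightarrow> a n * of_real 1 ^ n"
      by (intro tendsto_intros \<rho>)
    moreover have "(\<lambda>j. \<Sum>i\<le>n. F (k j) i * G (k j) (n - i)) \<longlonglongrightarrow> (\<Sum>i\<le>n. f i * g (n - i))"
      by (intro tendsto_intros f g)
    moreover have "\<forall>\<^sub>F j in sequentially.
        a n * of_real (\<rho> (k j)) ^ n = (\<Sum>i\<le>n. F (k j) i * G (k j) (n - i))"
      using eventually_gt_at_top[of n]
    proof eventually_elim
      case (elim j)
      then show ?case using *(3)[of n "k j"] seq_suble[OF k(1), of j] by simp
    qed
    ultimately have "a n * of_real 1 ^ n = (\<Sum>i\<le>n. f i * g (n - i))"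
      by (intro tendsto_unique[OF sequentially_bot Lim_transform_eventually])
    then show "a n = (\<Sum>i\<le>n. f i * g (n - i))" by simp
  next
    fix K
    have "(\<lambda>j. \<Sum>i<K. (cmod (F (k j) i))\<^sup>2) \<longlonglongrightarrow> (\<Sum>i<K. (cmod (f i))\<^sup>2)"
      by (intro tendsto_intros f)
    then show "(\<Sum>i<K. (cmod (f i))\<^sup>2) \<le> M + 1" using *(4) by (intro LIMSEQ_le_const2) auto
    have "(\<lambda>j. \<Sum>i<K. (cmod (G (k j) i))\<^sup>2) \<longlonglongrightarrow> (\<Sum>i<K. (cmod (g i))\<^sup>2)"
      by (intro tendsto_intros g)
    then show "(\<Sum>i<K. (cmod (g i))\<^sup>2) \<le> M + 1" using *(5) by (intro LIMSEQ_le_const2) auto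
  qed
qed



section \<open>Dual spaces and compact operators\<close>

lemma bounded_clinear_cdual_apply: "bounded_clinear (cdual_apply \<phi>)"
  using cdual_apply[of \<phi>] by simp

lemma cdual_apply_add_right: "cdual_apply \<phi> (x + y) = cdual_apply \<phi> x + cdual_apply \<phi> y"
  and cdual_apply_scaleC_right: "cdual_apply \<phi> (c *\<^sub>C x) = c * cdual_apply \<phi> x"
  and cdual_apply_sum_right: "cdual_apply \<phi> (\<Sum>i\<in>I. h i) = (\<Sum>i\<in>I. cdual_apply \<phi> (h i))"
  and cdual_apply_zero_right: "cdual_apply \<phi> 0 = 0"
proof -
  have bl: "bounded_linear (cdual_apply \<phi>)" and c: "\<And>c x. cdual_apply \<phi> (c *\<^sub>C x) = c *\<^sub>C cdual_apply \<phi> x"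
    using bounded_clinear_cdual_apply[of \<phi>] by (auto simp: bounded_clinear_def)
  then have l: "linear (cdual_apply \<phi>)" by (simp add: bounded_linear.linear)
  show "cdual_apply \<phi> (x + y) = cdual_apply \<phi> x + cdual_apply \<phi> y" by (rule linear_add[OF l])
  show "cdual_apply \<phi> (c *\<^sub>C x) = c * cdual_apply \<phi> x" by (simp add: c scaleC_complex_def)
  show "cdual_apply \<phi> (\<Sum>i\<in>I. h i) = (\<Sum>i\<in>I. cdual_apply \<phi> (h i))" by (rule linear_sum[OF l])
  show "cdual_apply \<phi> 0 = 0" by (rule linear_0[OF l])
qed

lemma cdual_apply_sum_left: "cdual_apply (\<Sum>i\<in>I. \<phi> i) x = (\<Sum>i\<in>I. cdual_apply (\<phi> i) x)"
  by (induction I rule: infinite_finite_induct) (auto simp: zero_cdual.rep_eq plus_cdual.rep_eq)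

lemma norm_cdual_apply_le: "cmod (cdual_apply \<phi> x) \<le> norm \<phi> * norm x"
  using bounded_clinear_cdual_apply[of \<phi>] by (simp add: bounded_clinear_def norm_cdual.rep_eq onorm)

lemma norm_cdual_leI:
  assumes "0 \<le> M" "\<And>x. cmod (cdual_apply \<phi> x) \<le> M * norm x"
  shows "norm \<phi> \<le> M"
  unfolding norm_cdual.rep_eq using assms by (rule onorm_bound)

lemma bounded_bilinear_cdual_apply: "bounded_bilinear cdual_apply"
proof
  show "\<exists>K. \<forall>\<phi> x. norm (cdual_apply \<phi> x) \<le> norm \<phi> * norm x * K"
    by (intro exI[of _ 1]) (simp add: norm_cdual_apply_le)
qed (simp_all add: plus_cdual.rep_eq cdual_apply_add_right scaleR_scaleC scaleC_cdual.rep_eq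
    cdual_apply_scaleC_right scaleC_complex_def)

text \<open>\<open>J\<close> embeds the dual isometrically into the complete space of real-linear
  bounded maps \<open>'a \<Rightarrow>\<^sub>L complex\<close>; complex linearity survives because
  norm limits are pointwise limits.\<close>

lemma complete_cdual: "complete (UNIV :: 'a::complex_normed_space cdual set)"
proof (rule completeI)
  fix \<phi> :: "nat \<Rightarrow> 'a cdual"
  assume "Cauchy \<phi>"
  define J :: "'a cdual \<Rightarrow> 'a \<Rightarrow>\<^sub>L complex" where "J = (\<lambda>\<phi>. Blinfun (cdual_apply \<phi>))"
  have J: "blinfun_apply (J \<phi>) = cdual_apply \<phi>" for \<phi>
    using bounded_clinear_cdual_apply[of \<phi>]
    by (simp add: J_def bounded_clinear_def bounded_linear_Blinfun_apply)
  have nJ: "norm (J \<phi>) = norm \<phi>" for \<phi> by (simp add: norm_blinfun.rep_eq norm_cdual.rep_eq J)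
  have Jd: "J \<phi> - J \<psi> = J (\<phi> - \<psi>)" for \<phi> \<psi>
    by (rule blinfun_eqI) (simp add: J blinfun.diff_left minus_cdual.rep_eq)
  have "Cauchy (\<lambda>n. J (\<phi> n))"
    using \<open>Cauchy \<phi>\<close> by (simp add: Cauchy_def dist_norm Jd nJ)
  then obtain L where L: "(\<lambda>n. J (\<phi> n)) \<longlonglongrightarrow> L" by (auto simp: Cauchy_convergent_iff convergent_def)
  have "blinfun_apply L (c *\<^sub>C x) = c * blinfun_apply L x" for c x
  proof -
    have pt: "(\<lambda>n. blinfun_apply (J (\<phi> n)) y) \<longlonglongrightarrow> blinfun_apply L y" for y
      by (intro tendsto_intros L)
    have "(\<lambda>n. blinfun_apply (J (\<phi> n)) (c *\<^sub>C x)) \<longlonglongrightarrow> c * blinfun_apply L x"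
      unfolding J cdual_apply_scaleC_right by (intro tendsto_intros pt[unfolded J])
    then show ?thesis using pt by (rule LIMSEQ_unique[rotated])
  qed
  then have "bounded_clinear (blinfun_apply L)"
    by (simp add: bounded_clinear_def scaleC_complex_def blinfun.bounded_linear_right)
  then have "cdual_apply (Abs_cdual (blinfun_apply L)) = blinfun_apply L"
    by (simp add: Abs_cdual_inverse)
  then have JL: "J (Abs_cdual (blinfun_apply L)) = L"
    by (simp add: J_def blinfun_apply_inverse)
  have eq: "norm (J (\<phi> n) - L) = norm (\<phi> n - Abs_cdual (blinfun_apply L))" for n
    using Jd[of "\<phi> n" "Abs_cdual (blinfun_apply L)"] nJ by (simp add: JL)
  have "(\<lambda>n. norm (J (\<phi> n) - L)) \<longlonglongrightarrow> 0" by (rule tendsto_norm_zero[OF LIM_zero[OF L]])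
  then have "(\<lambda>n. norm (\<phi> n - Abs_cdual (blinfun_apply L))) \<longlonglongrightarrow> 0" by (simp only: eq)
  then have "\<phi> \<longlonglongrightarrow> Abs_cdual (blinfun_apply L)" by (rule LIM_zero_cancel[OF tendsto_norm_zero_cancel])
  then show "\<exists>l\<in>UNIV. \<phi> \<longlonglongrightarrow> l" by blast
qed

section \<open>Explicit finite-rank operators and their norm limits\<close>

definition finite_rank_op ::
    "(nat \<Rightarrow> 'a::complex_normed_space cdual) \<Rightarrow> (nat \<Rightarrow> 'b::complex_normed_space) \<Rightarrow> nat \<Rightarrow> 'a \<Rightarrow> 'b"
  where "finite_rank_op \<phi> \<psi> K u = (\<Sum>i<K. cdual_apply (\<phi> i) u *\<^sub>C \<psi> i)"

lemma bounded_linear_scaleC_left: "bounded_linear (\<lambda>c. c *\<^sub>C (\<psi>::'b::complex_normed_space))"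
  by (rule bounded_linear_intro[where K = "norm \<psi>"])
    (simp_all add: scaleC_add_left scaleC_scaleC scaleR_conv_of_real norm_scaleC
      scaleR_scaleC [where 'a = 'b])

lemma bounded_clinear_finite_rank_op: "bounded_clinear (finite_rank_op \<phi> \<psi> K)"
proof -
  have "bounded_linear (\<lambda>u. \<Sum>i<K. cdual_apply (\<phi> i) u *\<^sub>C \<psi> i)"
  proof (rule bounded_linear_sum)
    fix i
    show "bounded_linear (\<lambda>u. cdual_apply (\<phi> i) u *\<^sub>C \<psi> i)"
      using bounded_clinear_cdual_apply[of "\<phi> i"]
      by (intro bounded_linear_compose[OF bounded_linear_scaleC_left]) (simp add: bounded_clinear_def)
  qed
  then show ?thesis
    by (simp add: bounded_clinear_def finite_rank_op_def[abs_def] cdual_apply_scaleC_right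
        complex_vector.scale_sum_right)
qed

lemma finite_rank_finite_rank_op: "finite_rank (finite_rank_op \<phi> \<psi> K)"
  unfolding finite_rank_def
proof (intro exI[of _ "\<psi> ` {..<K}"] conjI subsetI)
  fix y assume "y \<in> range (finite_rank_op \<phi> \<psi> K)"
  then obtain u where y: "y = (\<Sum>i<K. cdual_apply (\<phi> i) u *\<^sub>C \<psi> i)" by (auto simp: finite_rank_op_def)
  show "y \<in> complex_vector.span (\<psi> ` {..<K})"
    unfolding y
    by (intro complex_vector.span_sum complex_vector.span_scale complex_vector.span_base imageI)
qed simp

text \<open>The explicit sum allows induction on its length: each summand maps the unit ball into
  the image \<open>Z\<close> of a closed disc under a continuous map, and sums of compact sets are
  compact.\<close>

lemma finite_rank_op_relatively_compact:
  "\<exists>Q. compact Q \<and> finite_rank_op \<phi> \<psi> K ` cball 0 1 \<subseteq> Q"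
proof (induction K)
  case 0
  show ?case by (intro exI[of _ "{0}"]) (auto simp: finite_rank_op_def)
next
  case (Suc K)
  then obtain Q where Q: "compact Q" "finite_rank_op \<phi> \<psi> K ` cball 0 1 \<subseteq> Q" by blast
  define Z where "Z = (\<lambda>c. c *\<^sub>C \<psi> K) ` cball 0 (norm (\<phi> K))"
  have "compact Z"
    unfolding Z_def
    by (intro compact_continuous_image linear_continuous_on bounded_linear_scaleC_left compact_cball)
  then have "compact {x + y |x y. x \<in> Q \<and> y \<in> Z}" using Q(1) by (rule compact_sums[rotated])
  moreover have "finite_rank_op \<phi> \<psi> (Suc K) u \<in> {x + y |x y. x \<in> Q \<and> y \<in> Z}" if u: "norm u \<le> 1" for u
  proof -
    have "cmod (cdual_apply (\<phi> K) u) \<le> norm (\<phi> K) * norm u" by (rule norm_cdual_apply_le)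
    also have "\<dots> \<le> norm (\<phi> K)" using u by (simp add: mult_left_le)
    finally have "cdual_apply (\<phi> K) u *\<^sub>C \<psi> K \<in> Z" unfolding Z_def by (intro imageI) simp
    moreover have "finite_rank_op \<phi> \<psi> K u \<in> Q" using Q(2) u by auto
    moreover have "finite_rank_op \<phi> \<psi> (Suc K) u = finite_rank_op \<phi> \<psi> K u + cdual_apply (\<phi> K) u *\<^sub>C \<psi> K"
      by (simp add: finite_rank_op_def)
    ultimately show ?thesis by blast
  qed
  ultimately show ?case by (intro exI[of _ "{x + y |x y. x \<in> Q \<and> y \<in> Z}"]) auto
qed

text \<open>As the dual is complete, total boundedness of the closure suffices. The three thirds of
  \<open>e\<close> pay for the passage to the closure, for the operator error, and for the finite
  net of \<open>Q\<close>.\<close>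

lemma compact_operator_limit:
  fixes T :: "'a::complex_normed_space \<Rightarrow> 'b::complex_normed_space cdual"
  assumes T: "bounded_clinear T"
    and near: "\<And>e. 0 < e \<Longrightarrow> \<exists>\<phi> \<psi> K. \<forall>u. norm u \<le> 1 \<longrightarrow> norm (T u - finite_rank_op \<phi> \<psi> K u) < e"
  shows "compact_operator T"
  unfolding compact_operator_def
proof (intro conjI T)
  show "compact (closure (T ` cball 0 1))"
    unfolding compact_eq_totally_bounded
  proof (intro conjI allI impI)
    show "complete (closure (T ` cball 0 1))"
      using complete_closed_subset[OF closed_closure subset_UNIV complete_cdual] .
    fix e :: real assume "0 < e"
    then have e: "0 < e / 3" by simp
    obtain \<phi> \<psi> K where TK: "\<And>u. norm u \<le> 1 \<Longrightarrow> norm (T u - finite_rank_op \<phi> \<psi> K u) < e / 3"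
      using near[OF e] by blast
    obtain Q where Q: "compact Q" "finite_rank_op \<phi> \<psi> K ` cball 0 1 \<subseteq> Q"
      using finite_rank_op_relatively_compact by blast
    obtain k where k: "finite k" "Q \<subseteq> (\<Union>x\<in>k. ball x (e / 3))"
      using Q(1) e unfolding compact_eq_totally_bounded by blast
    have "closure (T ` cball 0 1) \<subseteq> (\<Union>x\<in>k. ball x e)"
    proof
      fix y assume "y \<in> closure (T ` cball 0 1)"
      then obtain u where u: "norm u \<le> 1" "dist (T u) y < e / 3"
        using e unfolding closure_approachable by fastforce
      have "finite_rank_op \<phi> \<psi> K u \<in> Q" using Q(2) u(1) by auto
      then obtain x where x: "x \<in> k" "dist x (finite_rank_op \<phi> \<psi> K u) < e / 3" using k(2) by auto
      have "dist x y \<le> dist x (finite_rank_op \<phi> \<psi> K u) + dist (finite_rank_op \<phi> \<psi> K u) (T u) + dist (T u) y"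
        using dist_triangle[of x y "T u"] dist_triangle[of x "T u" "finite_rank_op \<phi> \<psi> K u"] by simp
      moreover have "dist (finite_rank_op \<phi> \<psi> K u) (T u) < e / 3"
        using TK[OF u(1)] by (simp add: dist_norm norm_minus_commute)
      ultimately have "dist x y < e" using x u by simp
      then show "y \<in> (\<Union>x\<in>k. ball x e)" using x by auto
    qed
    then show "\<exists>k. finite k \<and> closure (T ` cball 0 1) \<subseteq> (\<Union>x\<in>k. ball x e)" using k(1) by blast
  qed
qed

section \<open>Polynomials and power series in the disc algebra\<close>

definition disc_of :: "(complex \<Rightarrow> complex) \<Rightarrow> disc_algebra"
  where "disc_of \<phi> = Abs_disc_algebra (\<lambda>z. if z \<in> cball 0 1 then \<phi> z else 0)"

lemma disc_fun_disc_of: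
  assumes "continuous_on (cball 0 1) \<phi>" "\<phi> holomorphic_on ball 0 1" "cmod z \<le> 1"
  shows "disc_fun (disc_of \<phi>) z = \<phi> z"
proof -
  let ?f = "\<lambda>z. if z \<in> cball 0 1 then \<phi> z else 0"
  have "continuous_on (cball 0 1) ?f" using assms(1) by (rule continuous_on_eq) simp
  moreover have "?f holomorphic_on ball 0 1" using assms(2) by (rule holomorphic_transform) auto
  ultimately have "disc_fun (disc_of \<phi>) = ?f"
    unfolding disc_of_def by (intro Abs_disc_algebra_inverse) auto
  then show ?thesis using assms(3) by simp
qed

lemma continuous_on_disc_fun: "continuous_on (cball 0 1) (disc_fun f)"
  and holomorphic_on_disc_fun: "disc_fun f holomorphic_on ball 0 1"
  using disc_fun[of f] by auto

lemma disc_algebra_eqI: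
  assumes "\<And>z. cmod z \<le> 1 \<Longrightarrow> disc_fun f z = disc_fun g z"
  shows "f = g"
proof -
  have "disc_fun f z = disc_fun g z" for z
    using assms[of z] disc_fun[of f] disc_fun[of g] by (cases "cmod z \<le> 1") auto
  then show ?thesis by (simp add: disc_fun_inject [symmetric] fun_eq_iff)
qed

lemma norm_disc_fun_le: "cmod z \<le> 1 \<Longrightarrow> cmod (disc_fun f z) \<le> norm f"
  unfolding norm_disc_algebra_def by (rule cSUP_upper[OF _ bdd_above_disc_fun]) simp

lemma norm_disc_algebra_leI:
  "(\<And>z. cmod z \<le> 1 \<Longrightarrow> cmod (disc_fun f z) \<le> M) \<Longrightarrow> norm f \<le> M"
  unfolding norm_disc_algebra_def by (rule cSUP_least) auto

lemma disc_fun_sum: "disc_fun (\<Sum>i\<in>I. f i) z = (\<Sum>i\<in>I. disc_fun (f i) z)"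
  by (induction I rule: infinite_finite_induct)
    (auto simp: zero_disc_algebra.rep_eq plus_disc_algebra.rep_eq)

lemmas disc_fun_simps = zero_disc_algebra.rep_eq plus_disc_algebra.rep_eq minus_disc_algebra.rep_eq
  uminus_disc_algebra.rep_eq times_disc_algebra.rep_eq scaleC_disc_algebra.rep_eq disc_fun_sum

section \<open>Composition with entire functions, polynomial density and Taylor functionals\<close>

definition disc_comp :: "(complex \<Rightarrow> complex) \<Rightarrow> disc_algebra \<Rightarrow> disc_algebra"
  where "disc_comp \<psi> k = disc_of (\<lambda>z. \<psi> (disc_fun k z))"

lemma disc_fun_disc_comp:
  assumes "\<psi> holomorphic_on UNIV" "cmod z \<le> 1"
  shows "disc_fun (disc_comp \<psi> k) z = \<psi> (disc_fun k z)"
  unfolding disc_comp_def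
proof (rule disc_fun_disc_of[OF _ _ assms(2)])
  show "continuous_on (cball 0 1) (\<lambda>z. \<psi> (disc_fun k z))"
    using continuous_on_compose2[OF holomorphic_on_imp_continuous_on[OF assms(1)] continuous_on_disc_fun]
    by simp
  show "(\<lambda>z. \<psi> (disc_fun k z)) holomorphic_on ball 0 1"
    using holomorphic_on_compose_gen[OF holomorphic_on_disc_fun assms(1)] by (simp add: o_def)
qed

definition disc_poly :: "complex poly \<Rightarrow> disc_algebra \<Rightarrow> disc_algebra"
  where "disc_poly p = disc_comp (poly p)"

lemma disc_fun_disc_poly [simp]: "cmod z \<le> 1 \<Longrightarrow> disc_fun (disc_poly p k) z = poly p (disc_fun k z)"
  unfolding disc_poly_def by (rule disc_fun_disc_comp) (auto intro: holomorphic_intros)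

definition disc_one :: disc_algebra where "disc_one = disc_of (\<lambda>_. 1)"
definition disc_id :: disc_algebra where "disc_id = disc_of (\<lambda>z. z)"

lemma disc_fun_disc_one [simp]: "cmod z \<le> 1 \<Longrightarrow> disc_fun disc_one z = 1"
  unfolding disc_one_def by (rule disc_fun_disc_of) auto

lemma disc_fun_disc_id [simp]: "cmod z \<le> 1 \<Longrightarrow> disc_fun disc_id z = z"
  unfolding disc_id_def by (rule disc_fun_disc_of) (auto intro: continuous_intros)

lemma disc_one_mult [simp]: "disc_one * f = f" "f * disc_one = f"
  by (rule disc_algebra_eqI; simp add: disc_fun_simps)+

lemma disc_poly_mult: "disc_poly (p * q) k = disc_poly p k * disc_poly q k"
  and disc_poly_smult: "disc_poly (smult c p) k = c *\<^sub>C disc_poly p k"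
  and disc_poly_0: "disc_poly 0 k = 0"
  and disc_poly_pCons: "disc_poly (pCons c p) k = c *\<^sub>C disc_one + k * disc_poly p k"
  by (rule disc_algebra_eqI; simp add: disc_fun_simps)+

lemma norm_disc_one_le: "norm disc_one \<le> 1"
  by (rule norm_disc_algebra_leI) simp

text \<open>Replacing \<open>f n\<close> by \<open>f n * K ^ n\<close> and \<open>k\<close> by
  \<open>k / K\<close> moves all values into the closed unit disc, where the tail bound is uniform
  in \<open>z\<close>.\<close>

lemma disc_poly_power_series_tendsto:
  fixes f :: "nat \<Rightarrow> complex"
  assumes sm: "summable (\<lambda>n. cmod (f n) * K ^ n)" and K: "0 < K" "norm k \<le> K"
    and X: "\<And>z. cmod z \<le> 1 \<Longrightarrow> (\<lambda>n. f n * disc_fun k z ^ n) sums disc_fun X z"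
  shows "(\<lambda>n. disc_poly (poly_of_seq f n) k) \<longlonglongrightarrow> X"
proof -
  let ?f = "\<lambda>n. f n * of_real K ^ n"
  have nf: "cmod (?f n) = cmod (f n) * K ^ n" for n using K by (simp add: norm_mult norm_power)
  have sm': "summable (\<lambda>n. cmod (?f n))" using sm by (simp only: nf)
  define \<delta> where "\<delta> = (\<lambda>L. \<Sum>n. cmod (?f (n + L)))"
  have \<delta>: "\<delta> \<longlonglongrightarrow> 0" unfolding \<delta>_def by (rule suminf_exist_split2[OF sm'])
  have le: "norm (disc_poly (poly_of_seq f L) k - X) \<le> \<delta> L" for L
  proof (rule norm_disc_algebra_leI)
    fix z :: complex assume z: "cmod z \<le> 1"
    let ?w = "disc_fun k z / of_real K"
    have w: "cmod ?w \<le> 1"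
      using norm_disc_fun_le[OF z, of k] K by (simp add: norm_divide)
    have "?f n * ?w ^ n = f n * disc_fun k z ^ n" for n
      using K by (simp add: power_divide)
    then have s: "(\<lambda>n. ?f n * ?w ^ n) sums disc_fun X z"
      and p: "poly (poly_of_seq ?f L) ?w = poly (poly_of_seq f L) (disc_fun k z)"
      using X[OF z] by (simp_all only: poly_poly_of_seq)
    show "cmod (disc_fun (disc_poly (poly_of_seq f L) k - X) z) \<le> \<delta> L"
      using power_series_tail_bound[OF sm' w s, of L] z
      by (simp add: p disc_fun_simps \<delta>_def norm_minus_commute)
  qed
  have "(\<lambda>n. disc_poly (poly_of_seq f n) k - X) \<longlonglongrightarrow> 0"
    by (rule Lim_null_comparison[OF _ \<delta>]) (simp add: le)
  then show ?thesis by (rule LIM_zero_cancel)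
qed

text \<open>The Taylor series of \<open>u\<close> itself need not converge uniformly. The dilation
  \<open>v\<close> is holomorphic on a larger disc, where the Taylor series converges absolutely up
  to the unit circle, and uniform continuity keeps it close to \<open>u\<close>.\<close>

lemma disc_poly_dense:
  assumes "0 < e"
  shows "\<exists>p. norm (disc_poly p disc_id - u) < e"
proof -
  have "uniformly_continuous_on (cball 0 1) (disc_fun u)"
    by (intro compact_uniformly_continuous continuous_on_disc_fun compact_cball)
  then obtain d where "0 < d" "\<forall>z\<in>cball 0 1. \<forall>z'\<in>cball 0 1. dist z' z < d \<longrightarrow>
      dist (disc_fun u z') (disc_fun u z) < e / 2"
    unfolding uniformly_continuous_on_def using half_gt_zero[OF assms] by blast
  then have d: "0 < d" "\<And>z z'. \<lbrakk>cmod z \<le> 1; cmod z' \<le> 1; dist z' z < d\<rbrakk> \<Longrightarrow>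
      dist (disc_fun u z') (disc_fun u z) < e / 2"
    by simp_all
  \<comment> \<open>The lower bound 1/2 keeps \<open>r\<close> positive; \<open>1 - d / 2\<close>
    moves every point of the disc by less than \<open>d\<close>.\<close>
  define r where "r = max (1 / 2) (1 - d / 2)"
  have r: "0 < r" "r < 1" "1 - r < d" using d(1) by (auto simp: r_def)
  define v where "v = (\<lambda>z. disc_fun u (of_real r * z))"
  have sub: "(\<lambda>z::complex. of_real r * z) ` ball 0 (1 / r) \<subseteq> ball 0 1"
    using r by (auto simp: norm_mult field_simps)
  have v: "v holomorphic_on ball 0 (1 / r)"
    unfolding v_def
    using holomorphic_on_compose_gen[OF _ holomorphic_on_disc_fun sub] 
    by (simp add: o_def holomorphic_intros)
  have r1: "1 < 1 / r" using r by simp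
  have c: "cball 0 1 \<subseteq> ball (0::complex) (1 / r)" using r1 by auto
  define X where "X = disc_of v"
  have X: "disc_fun X z = v z" if "cmod z \<le> 1" for z
    unfolding X_def
  proof (rule disc_fun_disc_of[OF _ _ that])
    have v1: "v holomorphic_on cball 0 1" by (rule holomorphic_on_subset[OF v c])
    show "continuous_on (cball 0 1) v" by (rule holomorphic_on_imp_continuous_on[OF v1])
    show "v holomorphic_on ball 0 1" by (rule holomorphic_on_subset[OF v1]) auto
  qed
  have fe: "v has_fps_expansion fps_expansion v 0"
    using v r by (intro has_fps_expansion_fps_expansion[of "ball 0 (1 / r)"]) auto
  have "(\<lambda>n. disc_poly (poly_of_seq (fps_nth (fps_expansion v 0)) n) disc_id) \<longlonglongrightarrow> X"
  proof (rule disc_poly_power_series_tendsto[where K = 1])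
    show "summable (\<lambda>n. cmod (fps_nth (fps_expansion v 0) n) * 1 ^ n)"
      using has_fps_expansion_summable_norm(1)[OF fe v r1] by simp
    show "norm disc_id \<le> 1" by (rule norm_disc_algebra_leI) simp
    show "(\<lambda>n. fps_nth (fps_expansion v 0) n * disc_fun disc_id z ^ n) sums disc_fun X z"
      if "cmod z \<le> 1" for z
      using has_fps_expansion_summable_norm(2)[OF fe v r1 that] that by (simp add: X)
  qed simp
  then obtain n where n: "norm (disc_poly (poly_of_seq (fps_nth (fps_expansion v 0)) n) disc_id - X) < e / 2"
    using LIMSEQ_D[OF _ half_gt_zero[OF assms]] by blast
  have "norm (X - u) \<le> e / 2"
  proof (rule norm_disc_algebra_leI)
    fix z :: complex assume z: "cmod z \<le> 1"
    have "dist (of_real r * z) z = (1 - r) * cmod z"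
    proof -
      have "of_real r * z - z = - (of_real (1 - r) * z)" by (simp add: algebra_simps)
      then show ?thesis using r by (simp only: dist_norm norm_minus_cancel norm_mult norm_of_real)
    qed
    also have "\<dots> < d" using r z mult_left_le[of "cmod z" "1 - r"] by linarith
    finally have "dist (disc_fun u (of_real r * z)) (disc_fun u z) < e / 2"
      using r z by (intro d(2)) (auto simp: norm_mult mult_le_one)
    then show "cmod (disc_fun (X - u) z) \<le> e / 2"
      by (simp add: disc_fun_simps X[OF z] v_def dist_norm)
  qed
  then have "norm (disc_poly (poly_of_seq (fps_nth (fps_expansion v 0)) n) disc_id - u) < e"
    using n norm_triangle_ineq[of "disc_poly (poly_of_seq (fps_nth (fps_expansion v 0)) n) disc_id - X" "X - u"]
    by simp
  then show ?thesis by blast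
qed

lemma disc_poly_sequence:
  obtains p where "(\<lambda>n. disc_poly (p n) disc_id) \<longlonglongrightarrow> u"
proof -
  have "\<forall>n. \<exists>p. norm (disc_poly p disc_id - u) < inverse (real (Suc n))"
    by (intro allI disc_poly_dense) simp
  from choice[OF this] obtain p where p: "\<forall>n. norm (disc_poly (p n) disc_id - u) < inverse (real (Suc n))" ..
  have "(\<lambda>n. disc_poly (p n) disc_id - u) \<longlonglongrightarrow> 0"
    by (rule Lim_null_comparison[OF _ LIMSEQ_inverse_real_of_nat])
      (use p in \<open>auto intro!: always_eventually less_imp_le\<close>)
  then show ?thesis by (intro that) (rule LIM_zero_cancel)
qed

text \<open>The finite-rank operators act on the whole algebra, so coefficients are needed as
  bounded functionals. Cauchy's inequality on the unit circle, where \<open>u\<close> is merely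
  continuous, gives norm at most 1.\<close>

lift_definition taylor_coeff :: "nat \<Rightarrow> disc_algebra cdual"
  is "\<lambda>n u. (deriv ^^ n) (disc_fun u) 0 / fact n"
proof -
  fix n
  have "bounded_linear (\<lambda>u. (deriv ^^ n) (disc_fun u) 0 / fact n)"
  proof (rule bounded_linear_intro[where K = 1])
    fix u v :: disc_algebra and r :: real
    show "(deriv ^^ n) (disc_fun (u + v)) 0 / fact n
        = (deriv ^^ n) (disc_fun u) 0 / fact n + (deriv ^^ n) (disc_fun v) 0 / fact n"
      using higher_deriv_add[OF holomorphic_on_disc_fun holomorphic_on_disc_fun, of 0 n u v]
      by (simp add: plus_disc_algebra.rep_eq add_divide_distrib)
    show "(deriv ^^ n) (disc_fun (r *\<^sub>R u)) 0 / fact n = r *\<^sub>R ((deriv ^^ n) (disc_fun u) 0 / fact n)"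
      using higher_deriv_cmult[OF holomorphic_on_disc_fun, of 0 n "of_real r" u]
      by (simp add: scaleR_scaleC scaleC_disc_algebra.rep_eq scaleC_complex_def)
    have "cmod ((deriv ^^ n) (disc_fun u) 0) \<le> fact n * norm u / 1 ^ n"
      by (rule Cauchy_inequality)
        (auto simp: holomorphic_on_disc_fun continuous_on_disc_fun norm_disc_fun_le)
    then show "norm ((deriv ^^ n) (disc_fun u) 0 / fact n) \<le> norm u * 1"
      by (simp add: norm_divide divide_le_eq mult.commute)
  qed
  moreover have "(deriv ^^ n) (disc_fun (c *\<^sub>C u)) 0 / fact n = c *\<^sub>C ((deriv ^^ n) (disc_fun u) 0 / fact n)" for c u
    using higher_deriv_cmult[OF holomorphic_on_disc_fun, of 0 n c u]
    by (simp add: scaleC_disc_algebra.rep_eq scaleC_complex_def)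
  ultimately show "bounded_clinear (\<lambda>u. (deriv ^^ n) (disc_fun u) 0 / fact n)"
    by (simp add: bounded_clinear_def)
qed

lemma taylor_coeff_disc_poly: "cdual_apply (taylor_coeff n) (disc_poly p disc_id) = coeff p n"
proof -
  have "\<forall>\<^sub>F z in nhds 0. disc_fun (disc_poly p disc_id) z = poly p z"
    by (rule eventually_nhds_in_open[of "ball 0 1", THEN eventually_mono]) auto
  then have "disc_fun (disc_poly p disc_id) has_fps_expansion fps_of_poly p"
    unfolding has_fps_expansion_def by (auto elim: eventually_mono)
  from fps_nth_fps_expansion[OF this, of n] show ?thesis by (simp add: taylor_coeff.rep_eq)
qed



section \<open>Derivations\<close>

text \<open>Averaging a geometric series over the N-th roots of unity keeps the powers divisible by
  \<open>N\<close>. All terms share the denominator \<open>1 - x ^ N\<close>, which leaves a finite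
  sum to evaluate.\<close>

lemma sum_roots_cauchy_kernel:
  fixes x :: complex
  assumes "cmod x < 1" "0 < N"
  shows "(\<Sum>m<N. 1 / (1 - cis (2 * pi / real N) ^ m * x)) = of_nat N / (1 - x ^ N)"
proof -
  let ?w = "cis (2 * pi / real N)"
  have xN: "x ^ N \<noteq> 1"
  proof
    assume "x ^ N = 1"
    then have "cmod x ^ N = 1" by (metis norm_one norm_power)
    moreover have "cmod x ^ N < 1" using assms by (simp add: power_less_one_iff)
    ultimately show False by simp
  qed
  have wN: "(?w ^ m) ^ N = 1" for m
  proof -
    have "?w ^ N = 1" using assms(2) by (simp add: Complex.DeMoivre)
    then show ?thesis by (metis mult.commute power_mult power_one)
  qed
  have "1 / (1 - ?w ^ m * x) = (\<Sum>j<N. (?w ^ m) ^ j * x ^ j) / (1 - x ^ N)" for m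
  proof -
    have "(1 - ?w ^ m * x) * (\<Sum>j<N. (?w ^ m * x) ^ j) = 1 - (?w ^ m * x) ^ N"
      by (rule one_diff_power_eq [symmetric])
    also have "\<dots> = 1 - x ^ N" by (simp only: power_mult_distrib wN mult_1)
    finally have eq: "(1 - ?w ^ m * x) * (\<Sum>j<N. (?w ^ m) ^ j * x ^ j) = 1 - x ^ N"
      by (simp only: power_mult_distrib)
    then have "1 - ?w ^ m * x \<noteq> 0" using xN by auto
    then show ?thesis using eq xN by (simp add: divide_eq_eq eq_divide_eq mult.commute)
  qed
  then have "(\<Sum>m<N. 1 / (1 - ?w ^ m * x)) = (\<Sum>m<N. \<Sum>j<N. (?w ^ m) ^ j * x ^ j) / (1 - x ^ N)"
    by (simp only: sum_divide_distrib)
  also have "(\<Sum>m<N. \<Sum>j<N. (?w ^ m) ^ j * x ^ j) = (\<Sum>j<N. (\<Sum>m<N. (?w ^ m) ^ j) * x ^ j)"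
    by (subst sum.swap) (simp only: sum_distrib_right)
  also have "\<dots> = (\<Sum>j<N. if j = 0 then of_nat N else 0)"
    by (intro sum.cong refl) (use sum_root_of_unity_powers[of _ N] in auto)
  also have "\<dots> = of_nat N" using assms(2) by simp
  finally show ?thesis .
qed

text \<open>The generating function of the monomials. There is no conjugate on \<open>c\<close>, so
  that applying a functional yields a power series in \<open>c\<close>.\<close>

definition cauchy_kernel :: "complex \<Rightarrow> disc_algebra"
  where "cauchy_kernel c = disc_of (\<lambda>z. 1 / (1 - c * z))"

lemma disc_fun_cauchy_kernel:
  assumes "cmod c < 1" "cmod z \<le> 1"
  shows "disc_fun (cauchy_kernel c) z = 1 / (1 - c * z)"
proof -
  have nz: "1 - c * w \<noteq> 0" if "cmod w \<le> 1" for w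
  proof
    assume "1 - c * w = 0"
    then have "cmod c * cmod w = 1" by (metis eq_iff_diff_eq_0 norm_mult norm_one)
    then show False using assms(1) that mult_left_le[of "cmod w" "cmod c"] by simp
  qed
  show ?thesis
    unfolding cauchy_kernel_def
    by (rule disc_fun_disc_of[OF _ _ assms(2)])
      (use nz in \<open>auto intro!: continuous_intros holomorphic_intros\<close>)
qed

section \<open>The bilinear form of a derivation and the chain rule\<close>

locale disc_derivation =
  fixes D :: "disc_algebra \<Rightarrow> disc_algebra cdual"
  assumes derivation: "D \<in> bounded_derivations"
begin

definition B :: "disc_algebra \<Rightarrow> disc_algebra \<Rightarrow> complex"
  where "B f g = cdual_apply (D f) g"

definition C :: real where "C = onorm D"

lemma bounded_linear_D: "bounded_linear D"
  and bounded_clinear_D: "bounded_clinear D"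
  using derivation by (auto simp: bounded_derivations_def bounded_clinear_def)

lemma C_nonneg: "0 \<le> C"
  unfolding C_def by (rule onorm_pos_le[OF bounded_linear_D])

lemma norm_B_le: "cmod (B f g) \<le> C * norm f * norm g"
proof -
  have "cmod (B f g) \<le> norm (D f) * norm g" unfolding B_def by (rule norm_cdual_apply_le)
  also have "\<dots> \<le> C * norm f * norm g"
    unfolding C_def by (intro mult_right_mono onorm bounded_linear_D) simp
  finally show ?thesis .
qed

lemma B_add_left: "B (f + g) h = B f h + B g h"
  and B_scaleC_left: "B (c *\<^sub>C f) h = c * B f h"
  and B_diff_left: "B (f - g) h = B f h - B g h"
  using derivation linear_add[OF bounded_linear.linear[OF bounded_linear_D]]
    linear_diff[OF bounded_linear.linear[OF bounded_linear_D]]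
  by (simp_all add: B_def bounded_derivations_def bounded_clinear_def plus_cdual.rep_eq
      minus_cdual.rep_eq scaleC_cdual.rep_eq)

lemma B_zero_left: "B 0 h = 0"
  using B_diff_left[of 0 0 h] by simp

lemma B_sum_left: "B (\<Sum>i\<in>I. f i) h = (\<Sum>i\<in>I. B (f i) h)"
  by (induction I rule: infinite_finite_induct) (simp_all add: B_zero_left B_add_left)

lemma B_add_right: "B f (g + h) = B f g + B f h"
  and B_scaleC_right: "B f (c *\<^sub>C h) = c * B f h"
  and B_sum_right: "B f (\<Sum>i\<in>I. k i) = (\<Sum>i\<in>I. B f (k i))"
  by (simp_all add: B_def cdual_apply_add_right cdual_apply_scaleC_right cdual_apply_sum_right)

lemma B_tendsto:
  assumes "f \<longlonglongrightarrow> f'" "g \<longlonglongrightarrow> g'"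
  shows "(\<lambda>n. B (f n) (g n)) \<longlonglongrightarrow> B f' g'"
  unfolding B_def
  by (intro bounded_bilinear.tendsto[OF bounded_bilinear_cdual_apply]
      bounded_linear.tendsto[OF bounded_linear_D] assms)

lemma B_mult: "B (f * g) h = B g (f * h) + B f (g * h)"
  using derivation
  by (simp add: B_def bounded_derivations_def plus_cdual.rep_eq cdual_apply_module_action)

lemma B_disc_one: "B disc_one g = 0"
  using B_mult[of disc_one disc_one g] by simp

text \<open>The chain rule, by Horner's scheme. The second argument varies in the induction because
  the Leibniz rule moves the factor \<open>k\<close> into it.\<close>

lemma B_disc_poly: "B (disc_poly p k) g = B k (disc_poly (pderiv p) k * g)"
proof (induction p arbitrary: g)
  case 0
  show ?case by (simp add: disc_poly_0 B_zero_left) (simp add: B_def cdual_apply_zero_right)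
next
  case (pCons a p)
  have "B (disc_poly (pCons a p) k) g = B (disc_poly p k) (k * g) + B k (disc_poly p k * g)"
    by (simp add: disc_poly_pCons B_add_left B_scaleC_left B_disc_one B_mult)
  also have "\<dots> = B k (disc_poly (pderiv p) k * (k * g) + disc_poly p k * g)"
    by (simp add: pCons.IH B_add_right)
  also have "disc_poly (pderiv p) k * (k * g) + disc_poly p k * g = disc_poly (pderiv (pCons a p)) k * g"
    by (rule disc_algebra_eqI) (simp add: disc_fun_simps pderiv_pCons algebra_simps)
  finally show ?case .
qed

lemma B_exp: "B (disc_comp exp k) g = B k (disc_comp exp k * g)"
proof -
  define f where "f = (\<lambda>n. 1 / fact n :: complex)"
  define K where "K = norm k + 1"
  have K: "0 < K" "norm k \<le> K" by (auto simp: K_def add_nonneg_pos)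
  have lim: "(\<lambda>n. disc_poly (poly_of_seq f n) k) \<longlonglongrightarrow> disc_comp exp k"
  proof (rule disc_poly_power_series_tendsto[OF _ K])
    show "summable (\<lambda>n. cmod (f n) * K ^ n)"
      using summable_exp[of K] by (simp add: f_def norm_inverse divide_inverse)
    show "(\<lambda>n. f n * disc_fun k z ^ n) sums disc_fun (disc_comp exp k) z" if "cmod z \<le> 1" for z
      using exp_converges[of "disc_fun k z"] that
      by (simp add: disc_fun_disc_comp holomorphic_on_exp f_def scaleR_conv_of_real divide_inverse)
  qed
  \<comment> \<open>Differentiating a truncated exponential series shortens it by one term, so both
    sides of the chain rule converge along shifted truncations.\<close>
  have pd: "pderiv (poly_of_seq f (Suc n)) = poly_of_seq f n" for n
    by (rule poly_eqI) (simp add: coeff_pderiv f_def del: of_nat_Suc)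
  have "(\<lambda>n. B (disc_poly (poly_of_seq f (Suc n)) k) g) \<longlonglongrightarrow> B (disc_comp exp k) g"
    by (intro B_tendsto tendsto_intros LIMSEQ_Suc[OF lim])
  moreover have "(\<lambda>n. B k (disc_poly (poly_of_seq f n) k * g)) \<longlonglongrightarrow> B k (disc_comp exp k * g)"
    by (intro B_tendsto tendsto_intros lim)
  ultimately show ?thesis unfolding B_disc_poly pd by (rule LIMSEQ_unique)
qed

text \<open>If \<open>Re k\<close> is bounded, then so are \<open>exp k\<close> and \<open>exp (- k)\<close>, whatever the size of \<open>Im k\<close>,
  and \<open>(exp k)' * exp (- k) = k'\<close>.\<close>
lemma norm_B_one_le_Re:
  assumes "\<And>z. cmod z \<le> 1 \<Longrightarrow> \<bar>Re (disc_fun k z)\<bar> \<le> 1"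
  shows "cmod (B k disc_one) \<le> C * (exp 1)\<^sup>2"
proof -
  have "disc_comp exp k * disc_comp exp (- k) = disc_one"
    by (rule disc_algebra_eqI)
      (simp add: disc_fun_simps disc_fun_disc_comp holomorphic_on_exp exp_minus)
  then have "B k disc_one = B (disc_comp exp k) (disc_comp exp (- k))" by (simp add: B_exp)
  then have "cmod (B k disc_one) \<le> C * norm (disc_comp exp k) * norm (disc_comp exp (- k))"
    using norm_B_le by simp
  also have "\<dots> \<le> C * exp 1 * exp 1"
  proof (intro mult_mono C_nonneg order_refl norm_ge_zero mult_nonneg_nonneg)
    show "norm (disc_comp exp k) \<le> exp 1" "norm (disc_comp exp (- k)) \<le> exp 1"
      using assms
      by (auto intro!: norm_disc_algebra_leI
          simp: disc_fun_disc_comp holomorphic_on_exp disc_fun_simps abs_le_iff)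
  qed auto
  finally show ?thesis by (simp add: power2_eq_square mult.assoc)
qed

section \<open>The sequence \<open>a\<close> and the Hardy space bound for its generating
  function\<close>

definition a :: "nat \<Rightarrow> complex"
  where "a n = B (disc_poly (monom 1 n) disc_id) disc_one"

lemma norm_disc_monom_le: "norm (disc_poly (monom 1 n) disc_id) \<le> 1"
  by (rule norm_disc_algebra_leI) (simp add: poly_monom norm_power power_le_one)

lemma norm_a_le: "cmod (a n) \<le> C"
proof -
  have "cmod (a n) \<le> C * norm (disc_poly (monom 1 n) disc_id) * norm disc_one"
    unfolding a_def by (rule norm_B_le)
  also have "\<dots> \<le> C * 1 * 1"
    by (intro mult_mono order_refl norm_disc_monom_le norm_disc_one_le C_nonneg mult_nonneg_nonneg) auto
  finally show ?thesis by simp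
qed

lemma disc_poly_eq_sum:
  assumes "degree p < N"
  shows "disc_poly p k = (\<Sum>i<N. coeff p i *\<^sub>C disc_poly (monom 1 i) k)"
  by (rule disc_algebra_eqI)
    (simp add: disc_fun_simps poly_monom poly_eq_sum_lessThan[OF assms])

definition H :: "complex \<Rightarrow> complex" where "H c = B (cauchy_kernel c) disc_one"

lemma a_sums_H:
  assumes "cmod c < 1"
  shows "(\<lambda>n. a n * c ^ n) sums H c"
proof -
  have "(\<lambda>n. disc_poly (poly_of_seq (\<lambda>n. c ^ n) n) disc_id) \<longlonglongrightarrow> cauchy_kernel c"
  proof (rule disc_poly_power_series_tendsto[where K = 1])
    show "summable (\<lambda>n. cmod (c ^ n) * 1 ^ n)" using assms by (simp add: norm_power summable_geometric)
    show "norm disc_id \<le> 1" by (rule norm_disc_algebra_leI) simp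
    show "(\<lambda>n. c ^ n * disc_fun disc_id z ^ n) sums disc_fun (cauchy_kernel c) z" if z: "cmod z \<le> 1" for z
    proof -
      have "cmod (c * z) < 1"
        using assms z mult_left_le[of "cmod z" "cmod c"] by (simp add: norm_mult)
      from geometric_sums[OF this] show ?thesis
        using z by (simp add: disc_fun_cauchy_kernel assms power_mult_distrib)
    qed
  qed simp
  then have "(\<lambda>n. B (disc_poly (poly_of_seq (\<lambda>n. c ^ n) n) disc_id) disc_one) \<longlonglongrightarrow> H c"
    unfolding H_def by (intro B_tendsto tendsto_const)
  moreover have "B (disc_poly (poly_of_seq (\<lambda>n. c ^ n) n) disc_id) disc_one = (\<Sum>i<n. a i * c ^ i)" for n
  proof -
    have "disc_poly (poly_of_seq (\<lambda>n. c ^ n) n) disc_id = (\<Sum>i<n. c ^ i *\<^sub>C disc_poly (monom 1 i) disc_id)"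
      by (rule disc_algebra_eqI) (simp add: disc_fun_simps poly_monom poly_poly_of_seq)
    then show ?thesis by (simp add: B_sum_left B_scaleC_left a_def mult.commute)
  qed
  ultimately show ?thesis by (simp add: sums_def)
qed

text \<open>For \<open>k\<close> the average of \<open>t m * (1 / (1 - c m * z) - 1 / 2)\<close>, where \<open>c m\<close> runs over the points
  \<open>r * w ^ m\<close>, positivity of the Poisson kernel gives \<open>\<bar>Re k\<bar> \<le> 1\<close>; the constant \<open>1 / 2\<close> is annihilated
  by \<open>D\<close>.\<close>
lemma norm_sum_real_H_le:
  fixes t :: "nat \<Rightarrow> real"
  assumes t: "\<And>m. \<bar>t m\<bar> \<le> 1" and r: "0 < r" "r < 1" and N: "0 < N" "r ^ N \<le> 1 / 3"
  shows "cmod (\<Sum>m<N. of_real (t m) * H (of_real r * cis (2 * pi / real N) ^ m)) \<le> real N * (C * (exp 1)\<^sup>2)"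
proof -
  define c where "c = (\<lambda>m. complex_of_real r * cis (2 * pi / real N) ^ m)"
  have c: "cmod (c m) < 1" for m using r by (simp add: c_def norm_mult norm_power)
  define k where "k = (\<Sum>m<N. of_real (t m / real N) *\<^sub>C (cauchy_kernel (c m) - (1 / 2) *\<^sub>C disc_one))"
  have Bk: "B k disc_one = (\<Sum>m<N. of_real (t m) * H (c m)) / of_nat N"
    by (simp add: k_def B_sum_left B_scaleC_left B_diff_left B_disc_one H_def sum_divide_distrib)
  have "cmod (B k disc_one) \<le> C * (exp 1)\<^sup>2"
  proof (rule norm_B_one_le_Re)
    fix z :: complex assume z: "cmod z \<le> 1"
    define q where "q = (\<lambda>m. Re (1 / (1 - c m * z)) - 1 / 2)"
    have cz: "cmod (c m * z) < 1" for m
      using c[of m] z mult_left_le[of "cmod z" "cmod (c m)"] by (simp add: norm_mult)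
    \<comment> \<open>With \<open>x = c m * z\<close>, \<open>q m\<close> is half the Poisson
      kernel, \<open>(1 - |x|^2) / (2 * |1 - x|^2)\<close>.\<close>
    have q0: "0 \<le> q m" for m
    proof -
      let ?x = "c m * z"
      have x1: "Re ?x < 1" using cz[of m] complex_Re_le_cmod[of ?x] by linarith
      have "(cmod ?x)\<^sup>2 \<le> 1" using cz[of m] by (simp add: power_le_one)
      then have "(cmod (1 - ?x))\<^sup>2 \<le> 2 * (1 - Re ?x)"
        unfolding cmod_power2 by (simp add: power2_eq_square algebra_simps)
      moreover have "0 < (cmod (1 - ?x))\<^sup>2" using cz[of m] by auto
      moreover have "Re (1 / (1 - ?x)) = (1 - Re ?x) / (cmod (1 - ?x))\<^sup>2"
        by (simp add: Re_divide cmod_power2)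
      ultimately show ?thesis by (simp add: q_def le_divide_eq)
    qed
    have "Re (disc_fun k z) = (\<Sum>m<N. t m / real N * q m)"
      by (simp add: k_def disc_fun_simps z disc_fun_cauchy_kernel c q_def flip: of_real_divide)
    also have "\<bar>\<dots>\<bar> \<le> (\<Sum>m<N. q m / real N)"
    proof (rule order_trans[OF sum_abs sum_mono])
      fix m
      have "\<bar>t m / real N * q m\<bar> = \<bar>t m\<bar> * (q m / real N)" using q0[of m] by (simp add: abs_mult)
      also have "\<dots> \<le> q m / real N" using t[of m] q0[of m] by (intro mult_left_le_one_le) auto
      finally show "\<bar>t m / real N * q m\<bar> \<le> q m / real N" .
    qed
    also have "\<dots> = Re ((\<Sum>m<N. 1 / (1 - c m * z)) / of_nat N) - 1 / 2"
      using N(1) by (simp add: q_def sum_subtractf diff_divide_distrib flip: sum_divide_distrib)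
    also have "(\<Sum>m<N. 1 / (1 - c m * z)) / of_nat N = 1 / (1 - (of_real r * z) ^ N)"
    proof -
      have "cmod (of_real r * z) < 1" using cz[of 0] by (simp add: c_def)
      from sum_roots_cauchy_kernel[OF this N(1)] show ?thesis
        using N(1) by (simp add: c_def mult_ac)
    qed
    \<comment> \<open>The threshold 1/3 on \<open>r ^ N\<close> is chosen for this bound: the
      denominator has modulus at least 2/3, and 3/2 - 1/2 = 1.\<close>
    also have "Re (1 / (1 - (of_real r * z) ^ N)) - 1 / 2 \<le> 1"
    proof -
      let ?x = "(of_real r * z) ^ N"
      have "cmod ?x = r ^ N * cmod z ^ N" using r by (simp add: norm_power norm_mult power_mult_distrib)
      also have "\<dots> \<le> r ^ N" using r z by (intro mult_left_le) (auto simp: power_le_one)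
      finally have x: "cmod ?x \<le> 1 / 3" using N(2) by simp
      then have "2 / 3 \<le> cmod (1 - ?x)" using norm_triangle_ineq2[of 1 ?x] by simp
      then have "cmod (1 / (1 - ?x)) \<le> 1 / (2 / 3)"
        unfolding norm_divide norm_one by (intro divide_left_mono) auto
      then show ?thesis using complex_Re_le_cmod[of "1 / (1 - ?x)"] by simp
    qed
    finally show "\<bar>Re (disc_fun k z)\<bar> \<le> 1" .
  qed
  then show ?thesis
    unfolding Bk using N(1) by (simp add: norm_divide divide_le_eq mult.commute c_def)
qed

text \<open>Multipliers \<open>\<epsilon> m\<close> aligned with the values of \<open>H\<close> turn
  the sum of moduli into a linear expression. \<open>norm_sum_real_H_le\<close> admits real
  multipliers, so real and imaginary parts are treated apart; this is the factor 2.\<close>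

lemma sum_norm_H_le:
  assumes r: "0 < r" "r < 1"
  shows "\<forall>\<^sub>F N in sequentially. (\<Sum>m<N. cmod (H (of_real r * cis (2 * pi / real N) ^ m)))
    \<le> real N * (2 * C * (exp 1)\<^sup>2)"
proof -
  have "(\<lambda>N. r ^ N) \<longlonglongrightarrow> 0" using r by (intro LIMSEQ_realpow_zero) auto
  then have "\<forall>\<^sub>F N in sequentially. r ^ N < 1 / 3" by (rule order_tendstoD) simp
  then show ?thesis using eventually_gt_at_top[of 0]
  proof eventually_elim
    case (elim N)
    define h where "h = (\<lambda>m. H (of_real r * cis (2 * pi / real N) ^ m))"
    define \<epsilon> where "\<epsilon> = (\<lambda>m. cnj (sgn (h m)))"
    have \<epsilon>1: "cmod (\<epsilon> m) \<le> 1" for m by (simp add: \<epsilon>_def norm_sgn)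
    have \<epsilon>h: "\<epsilon> m * h m = of_real (cmod (h m))" for m
      by (cases "h m = 0")
        (simp_all add: \<epsilon>_def sgn_eq complex_norm_square [symmetric] mult.commute power2_eq_square)
    have Re: "\<bar>Re (\<epsilon> m)\<bar> \<le> 1" and Im: "\<bar>Im (\<epsilon> m)\<bar> \<le> 1" for m
      using \<epsilon>1[of m] abs_Re_le_cmod[of "\<epsilon> m"] abs_Im_le_cmod[of "\<epsilon> m"] by linarith+
    have "complex_of_real (\<Sum>m<N. cmod (h m)) = (\<Sum>m<N. \<epsilon> m * h m)" by (simp add: \<epsilon>h)
    also have "\<dots> = (\<Sum>m<N. (of_real (Re (\<epsilon> m)) + \<i> * of_real (Im (\<epsilon> m))) * h m)"
      by (simp flip: complex_eq)
    also have "\<dots> = (\<Sum>m<N. of_real (Re (\<epsilon> m)) * h m) + \<i> * (\<Sum>m<N. of_real (Im (\<epsilon> m)) * h m)"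
      by (simp add: sum.distrib sum_distrib_left distrib_right mult.assoc)
    finally have "cmod (complex_of_real (\<Sum>m<N. cmod (h m)))
        \<le> cmod (\<Sum>m<N. of_real (Re (\<epsilon> m)) * h m) + cmod (\<Sum>m<N. of_real (Im (\<epsilon> m)) * h m)"
      by (metis (no_types, lifting) norm_ii norm_mult mult_1 norm_triangle_ineq)
    also have "\<dots> \<le> real N * (C * (exp 1)\<^sup>2) + real N * (C * (exp 1)\<^sup>2)"
      unfolding h_def
      by (intro add_mono norm_sum_real_H_le) (use r elim Re Im in auto)
    finally have "\<bar>\<Sum>m<N. cmod (h m)\<bar> \<le> real N * (2 * C * (exp 1)\<^sup>2)"
      by (simp only: norm_of_real)
    then show ?case by (simp add: h_def)
  qed
qed

section \<open>Polynomial symbols and the finite-rank approximants\<close>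

lemma B_disc_poly_disc_poly:
  assumes "degree (pderiv u * v) < K"
  shows "B (disc_poly u disc_id) (disc_poly v disc_id)
    = (\<Sum>m<K. coeff (pderiv u * v) m * a (Suc m) / of_nat (Suc m))"
proof -
  \<comment> \<open>The chain rule for \<open>z ^ (m + 1)\<close>. It expresses
    \<open>B disc_id\<close> on monomials through \<open>a\<close>, and \<open>B disc_id\<close>
    determines \<open>B\<close> on polynomials.\<close>
  have "a (Suc m) = of_nat (Suc m) * B disc_id (disc_poly (monom 1 m) disc_id)" for m
  proof -
    have "pderiv (monom 1 (Suc m)) = smult (of_nat (Suc m)) (monom 1 m :: complex poly)"
      by (simp add: pderiv_monom smult_monom)
    then show ?thesis by (simp add: a_def B_disc_poly disc_poly_smult B_scaleC_right del: of_nat_Suc)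
  qed
  then have a: "a (Suc m) / of_nat (Suc m) = B disc_id (disc_poly (monom 1 m) disc_id)" for m
    by (simp del: of_nat_Suc)
  have "B (disc_poly u disc_id) (disc_poly v disc_id) = B disc_id (disc_poly (pderiv u * v) disc_id)"
    by (simp add: B_disc_poly disc_poly_mult)
  then show ?thesis
    by (simp add: disc_poly_eq_sum[OF assms] B_sum_right B_scaleC_right a flip: times_divide_eq_right del: of_nat_Suc)
qed

text \<open>The functional that multiplies the Taylor coefficient \<open>i + 1\<close> of
  \<open>u\<close>: the factor \<open>Suc i\<close> comes from differentiating \<open>u\<close>, and
  \<open>m - i\<close> is the index left for \<open>v\<close> in the convolution
  \<open>u' * v\<close>.\<close>

definition tail_coeffs :: "complex poly \<Rightarrow> nat \<Rightarrow> nat \<Rightarrow> disc_algebra cdual"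
  where "tail_coeffs P K i =
    (\<Sum>m<K. (if i \<le> m then coeff P (Suc m) * of_nat (Suc i) / of_nat (Suc m) else 0) *\<^sub>C taylor_coeff (m - i))"

text \<open>On polynomials this is the formula for \<open>D\<close> with \<open>a\<close> replaced
  by the coefficients of \<open>P\<close> and the sum cut at \<open>K\<close>, so its difference
  from \<open>D\<close> is a pairing of the same kind with another symbol.\<close>

definition poly_op :: "complex poly \<Rightarrow> nat \<Rightarrow> disc_algebra \<Rightarrow> disc_algebra cdual"
  where "poly_op P K = finite_rank_op (\<lambda>i. taylor_coeff (Suc i)) (tail_coeffs P K) K"

lemma poly_op_disc_poly:
  "cdual_apply (poly_op P K (disc_poly u disc_id)) (disc_poly v disc_id)
    = (\<Sum>m<K. coeff (pderiv u * v) m * coeff P (Suc m) / of_nat (Suc m))"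
proof -
  have "cdual_apply (poly_op P K (disc_poly u disc_id)) (disc_poly v disc_id)
    = (\<Sum>i<K. \<Sum>m<K. if i \<le> m then coeff (pderiv u) i * coeff v (m - i) * coeff P (Suc m) / of_nat (Suc m) else 0)"
    by (auto simp: poly_op_def finite_rank_op_def tail_coeffs_def cdual_apply_sum_left scaleC_cdual.rep_eq
        taylor_coeff_disc_poly sum_distrib_left coeff_pderiv mult_ac simp del: of_nat_Suc intro!: sum.cong)
  also have "\<dots> = (\<Sum>m<K. \<Sum>i<K. if i \<le> m then coeff (pderiv u) i * coeff v (m - i) * coeff P (Suc m) / of_nat (Suc m) else 0)"
    by (rule sum.swap)
  also have "\<dots> = (\<Sum>m<K. \<Sum>i\<le>m. coeff (pderiv u) i * coeff v (m - i) * coeff P (Suc m) / of_nat (Suc m))"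
  proof (rule sum.cong [OF refl])
    fix m assume "m \<in> {..<K}"
    then have "{..m} = {i \<in> {..<K}. i \<le> m}" by auto
    then show "(\<Sum>i<K. if i \<le> m then coeff (pderiv u) i * coeff v (m - i) * coeff P (Suc m) / of_nat (Suc m) else 0)
        = (\<Sum>i\<le>m. coeff (pderiv u) i * coeff v (m - i) * coeff P (Suc m) / of_nat (Suc m))"
      by (simp only: sum.inter_filter[OF finite_lessThan])
  qed
  finally show ?thesis by (simp add: coeff_mult sum_distrib_right sum_divide_distrib)
qed

lemma norm_D_diff_leI:
  assumes T: "bounded_linear T" and \<eta>: "0 \<le> \<eta>"
    and le: "\<And>u v. cmod (cdual_apply (D (disc_poly u disc_id) - T (disc_poly u disc_id)) (disc_poly v disc_id))
      \<le> \<eta> * norm (disc_poly u disc_id) * norm (disc_poly v disc_id)"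
  shows "norm (D f - T f) \<le> \<eta> * norm f"
proof (rule norm_cdual_leI)
  show "0 \<le> \<eta> * norm f" using \<eta> by simp
  fix g
  obtain p where p: "(\<lambda>n. disc_poly (p n) disc_id) \<longlonglongrightarrow> f" by (rule disc_poly_sequence)
  obtain q where q: "(\<lambda>n. disc_poly (q n) disc_id) \<longlonglongrightarrow> g" by (rule disc_poly_sequence)
  have "(\<lambda>n. cmod (cdual_apply (D (disc_poly (p n) disc_id) - T (disc_poly (p n) disc_id)) (disc_poly (q n) disc_id)))
      \<longlonglongrightarrow> cmod (cdual_apply (D f - T f) g)"
    by (intro tendsto_intros bounded_bilinear.tendsto[OF bounded_bilinear_cdual_apply]
        bounded_linear.tendsto[OF bounded_linear_D] bounded_linear.tendsto[OF T] p q)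
  moreover have "(\<lambda>n. \<eta> * norm (disc_poly (p n) disc_id) * norm (disc_poly (q n) disc_id)) \<longlonglongrightarrow> \<eta> * norm f * norm g"
    by (intro tendsto_intros p q)
  ultimately show "cmod (cdual_apply (D f - T f) g) \<le> \<eta> * norm f * norm g"
    by (rule LIMSEQ_le) (use le in auto)
qed

section \<open>Truncation errors and the approximation of \<open>D\<close>\<close>

lemma sum_norm_truncation_le:
  fixes f :: "nat \<Rightarrow> complex"
  assumes "\<And>K. (\<Sum>i<K. (cmod (f i))\<^sup>2) \<le> M"
  shows "(\<Sum>i<K. (cmod (coeff (poly_of_seq f L) i))\<^sup>2) \<le> M"
proof -
  have "(\<Sum>i<K. (cmod (coeff (poly_of_seq f L) i))\<^sup>2) \<le> (\<Sum>i<K. (cmod (f i))\<^sup>2)"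
    by (intro sum_mono) auto
  then show ?thesis using assms[of K] by linarith
qed

lemma summable_square_norm:
  fixes f :: "nat \<Rightarrow> complex"
  assumes "\<And>K. (\<Sum>i<K. (cmod (f i))\<^sup>2) \<le> M"
  shows "summable (\<lambda>i. (cmod (f i))\<^sup>2)"
  using assms by (intro bounded_imp_summable[of _ M]) (simp_all flip: lessThan_Suc_atMost del: sum.lessThan_Suc)

lemma sum_norm_truncation_diff_le:
  fixes f :: "nat \<Rightarrow> complex"
  assumes "\<And>K. (\<Sum>i<K. (cmod (f i))\<^sup>2) \<le> M" and NL: "N \<le> L"
  shows "(\<Sum>i<K. (cmod (coeff (poly_of_seq f L - poly_of_seq f N) i))\<^sup>2)
    \<le> (\<Sum>i. (cmod (f (i + N)))\<^sup>2)"
proof -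
  have sm: "summable (\<lambda>i. (cmod (f (i + N)))\<^sup>2)"
    by (rule summable_ignore_initial_segment[OF summable_square_norm[OF assms(1)]])
  have split: "(\<Sum>i<N + K. h i) = (\<Sum>i<N. h i) + (\<Sum>i<K. h (i + N))" for h :: "nat \<Rightarrow> real"
    by (induction K) (simp_all add: add_ac)
  have "(\<Sum>i<K. (cmod (coeff (poly_of_seq f L - poly_of_seq f N) i))\<^sup>2)
      \<le> (\<Sum>i<N + K. (cmod (coeff (poly_of_seq f L - poly_of_seq f N) i))\<^sup>2)"
    by (intro sum_mono2) auto
  also have "\<dots> = (\<Sum>i<K. (cmod (coeff (poly_of_seq f L - poly_of_seq f N) (i + N)))\<^sup>2)"
    using NL by (simp add: split)
  also have "\<dots> \<le> (\<Sum>i<K. (cmod (f (i + N)))\<^sup>2)" by (intro sum_mono) auto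
  also have "\<dots> \<le> (\<Sum>i. (cmod (f (i + N)))\<^sup>2)" by (intro sum_le_suminf sm) auto
  finally show ?thesis .
qed

text \<open>The symbols differ by \<open>(FL - FN) * GL + FN * (GL - GN)\<close>. Each product has
  one factor of H^2 norm at most \<open>A\<close> and one at most \<open>M\<close>, so
  \<open>paraproduct_bound\<close> gives \<open>5 * A * M\<close> twice. The auxiliary orders
  \<open>L\<close> and \<open>K\<close> depend on \<open>u\<close> and \<open>v\<close>, the bound
  does not.\<close>

lemma norm_D_minus_poly_op_le:
  fixes f g :: "nat \<Rightarrow> complex"
  assumes fg: "\<And>n. a n = (\<Sum>i\<le>n. f i * g (n - i))"
    and f: "\<And>K. (\<Sum>i<K. (cmod (f i))\<^sup>2) \<le> M\<^sup>2" and g: "\<And>K. (\<Sum>i<K. (cmod (g i))\<^sup>2) \<le> M\<^sup>2"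
    and M: "0 < M" and A: "0 < A" "(\<Sum>i. (cmod (f (i + N)))\<^sup>2) \<le> A\<^sup>2" "(\<Sum>i. (cmod (g (i + N)))\<^sup>2) \<le> A\<^sup>2"
  defines "T \<equiv> poly_op (poly_of_seq f N * poly_of_seq g N) (2 * N)"
  shows "norm (D h - T h) \<le> 10 * A * M * norm h"
proof (rule norm_D_diff_leI)
  show "bounded_linear T"
    using bounded_clinear_finite_rank_op by (auto simp: T_def poly_op_def bounded_clinear_def)
  show "0 \<le> 10 * A * M" using A M by simp
  fix u v :: "complex poly"
  let ?u = "disc_poly u disc_id" and ?v = "disc_poly v disc_id"
  show "cmod (cdual_apply (D ?u - T ?u) ?v) \<le> 10 * A * M * norm ?u * norm ?v"
  \<comment> \<open>\<open>paraproduct_bound\<close> divides by the norms, so they have to be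
    positive.\<close>
  proof (cases "?u = 0 \<or> ?v = 0")
    case True
    then have "cdual_apply (D ?u - T ?u) ?v = 0"
      using bounded_linear.linear[OF bounded_linear_D] bounded_linear.linear[OF \<open>bounded_linear T\<close>]
      by (auto simp: linear_0 cdual_apply_zero_right zero_cdual.rep_eq)
    then show ?thesis using A M by simp
  next
    case False
    \<comment> \<open>\<open>L\<close> exceeds every index \<open>m + 1\<close> at which
      \<open>u' * v\<close> contributes, so there \<open>a\<close> and the coefficients of the
      truncated product agree. \<open>K\<close> exceeds all sums of degrees that occur.\<close>
    define L where "L = degree u + degree v + N + 2"
    define K where "K = degree u + degree v + 4 * L"
    define S where "S = (\<lambda>P. \<Sum>m<K. coeff (pderiv u * v) m * coeff P (Suc m) / of_nat (Suc m))"
    let ?FL = "poly_of_seq f L" and ?GL = "poly_of_seq g L"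
    let ?FN = "poly_of_seq f N" and ?GN = "poly_of_seq g N"
    have NL: "N \<le> L" by (simp add: L_def)
    have degs: "degree (poly_of_seq h n) \<le> L" if "n \<le> L" for h n
      using degree_poly_of_seq[of n h] that by (cases "n = 0") (auto simp: poly_of_seq_def)
    have dp: "degree (pderiv u * v) \<le> degree u + degree v"
      using degree_mult_le[of "pderiv u" v] by (simp add: degree_pderiv)
    have D: "cdual_apply (D ?u) ?v = S (?FL * ?GL)"
    proof -
      have "B ?u ?v = (\<Sum>m<K. coeff (pderiv u * v) m * a (Suc m) / of_nat (Suc m))"
        by (rule B_disc_poly_disc_poly) (use dp in \<open>auto simp: K_def L_def\<close>)
      also have "\<dots> = S (?FL * ?GL)"
        unfolding S_def
      proof (intro sum.cong refl)
        fix m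
        show "coeff (pderiv u * v) m * a (Suc m) / of_nat (Suc m)
            = coeff (pderiv u * v) m * coeff (?FL * ?GL) (Suc m) / of_nat (Suc m)"
        proof (cases "m \<le> degree u + degree v")
          case True
          then have "a (Suc m) = coeff (?FL * ?GL) (Suc m)"
            unfolding fg coeff_mult by (intro sum.cong refl) (auto simp: L_def)
          then show ?thesis by simp
        qed (use dp in \<open>simp add: coeff_eq_0\<close>)
      qed
      finally show ?thesis by (simp add: B_def)
    qed
    have T: "cdual_apply (T ?u) ?v = S (?FN * ?GN)"
      unfolding T_def poly_op_disc_poly S_def
    proof (rule sum.mono_neutral_left)
      show "{..<2 * N} \<subseteq> {..<K}" by (auto simp: K_def L_def)
      \<comment> \<open>The product has degree at most \<open>2 * N - 2\<close>, so cutting the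
        operator at \<open>2 * N\<close> loses nothing; for \<open>N = 0\<close> both truncations
        vanish.\<close>
      have "coeff (?FN * ?GN) (Suc m) = 0" if "2 * N \<le> m" for m
      proof (cases "N = 0")
        case False
        then have "degree (?FN * ?GN) < Suc m"
          using degree_mult_le[of ?FN ?GN] degree_poly_of_seq[of N f] degree_poly_of_seq[of N g] that by linarith
        then show ?thesis by (rule coeff_eq_0)
      qed (simp add: poly_of_seq_def)
      then show "\<forall>m\<in>{..<K} - {..<2 * N}.
          coeff (pderiv u * v) m * coeff (?FN * ?GN) (Suc m) / of_nat (Suc m) = 0" by simp
    qed simp
    have "?FL * ?GL = (?FL - ?FN) * ?GL + ?FN * (?GL - ?GN) + ?FN * ?GN"
      by (simp add: algebra_simps)
    then have S: "S (?FL * ?GL) - S (?FN * ?GN) = S ((?FL - ?FN) * ?GL) + S (?FN * (?GL - ?GN))"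
      unfolding S_def by (simp only: coeff_add distrib_left add_divide_distrib sum.distrib) simp
    have U: "cmod (poly u z) \<le> norm ?u" "cmod (poly v z) \<le> norm ?v" if "cmod z \<le> 1" for z
      using norm_disc_fun_le[OF that, of ?u] norm_disc_fun_le[OF that, of ?v] that by simp_all
    have pos: "0 < norm ?u" "0 < norm ?v" using False by auto
    have d: "degree ?FL \<le> L" "degree ?GL \<le> L" "degree ?FN \<le> L" "degree ?GN \<le> L"
      using degs NL by auto
    have "cmod (S ((?FL - ?FN) * ?GL)) \<le> 5 * A * M * norm ?u * norm ?v"
      unfolding S_def
    proof (rule paraproduct_bound[OF U pos _ _ A(1) M])
      show "(\<Sum>i<K. (cmod (coeff (?FL - ?FN) i))\<^sup>2) \<le> A\<^sup>2"
        using sum_norm_truncation_diff_le[OF f NL] A(2) by (rule order_trans)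
      show "(\<Sum>i<K. (cmod (coeff ?GL i))\<^sup>2) \<le> M\<^sup>2" by (rule sum_norm_truncation_le[OF g])
      show "degree u + degree v + degree (?FL - ?FN) + degree ?GL < K"
        using degree_diff_le[OF d(1,3)] d(2) by (simp add: K_def L_def)
    qed
    moreover have "cmod (S (?FN * (?GL - ?GN))) \<le> 5 * M * A * norm ?u * norm ?v"
      unfolding S_def
    proof (rule paraproduct_bound[OF U pos _ _ M A(1)])
      show "(\<Sum>i<K. (cmod (coeff (?GL - ?GN) i))\<^sup>2) \<le> A\<^sup>2"
        using sum_norm_truncation_diff_le[OF g NL] A(3) by (rule order_trans)
      show "(\<Sum>i<K. (cmod (coeff ?FN i))\<^sup>2) \<le> M\<^sup>2" by (rule sum_norm_truncation_le[OF f])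
      show "degree u + degree v + degree ?FN + degree (?GL - ?GN) < K"
        using degree_diff_le[OF d(2,4)] d(3) by (simp add: K_def L_def)
    qed
    ultimately have "cmod (S ((?FL - ?FN) * ?GL) + S (?FN * (?GL - ?GN))) \<le> 10 * A * M * norm ?u * norm ?v"
      using norm_triangle_ineq[of "S ((?FL - ?FN) * ?GL)" "S (?FN * (?GL - ?GN))"] by (simp add: mult_ac)
    then show ?thesis by (simp add: minus_cdual.rep_eq D T S)
  qed
qed

text \<open>Both conclusions of the theorem rest on this one family: the rate \<open>\<eta>\<close>
  bounds the operator norm of the difference, and the explicit form of the operators gives
  compactness.\<close>

lemma finite_rank_approximation:
  obtains P :: "nat \<Rightarrow> complex poly" and \<eta> :: "nat \<Rightarrow> real"
  where "\<And>n h. norm (D h - poly_op (P n) (2 * n) h) \<le> \<eta> n * norm h" "\<And>n. 0 \<le> \<eta> n" "\<eta> \<longlonglongrightarrow> 0"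
proof -
  define M where "M = 2 * C * (exp 1)\<^sup>2"
  have M: "0 \<le> M" using C_nonneg by (simp add: M_def)
  obtain f g where fg: "\<And>n. a n = (\<Sum>i\<le>n. f i * g (n - i))"
    "\<And>K. (\<Sum>i<K. (cmod (f i))\<^sup>2) \<le> M + 1" "\<And>K. (\<Sum>i<K. (cmod (g i))\<^sup>2) \<le> M + 1"
    by (rule hardy_factorization[OF norm_a_le a_sums_H sum_norm_H_le M[unfolded M_def]])
      (simp_all add: M_def)
  define \<tau> where "\<tau> = (\<lambda>(h :: nat \<Rightarrow> complex) n. \<Sum>i. (cmod (h (i + n)))\<^sup>2)"
  have \<tau>: "\<tau> h \<longlonglongrightarrow> 0" "\<And>n. 0 \<le> \<tau> h n" if "\<And>K. (\<Sum>i<K. (cmod (h i))\<^sup>2) \<le> M + 1" for h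
  proof -
    have sm: "summable (\<lambda>i. (cmod (h i))\<^sup>2)" by (rule summable_square_norm[OF that])
    show "\<tau> h \<longlonglongrightarrow> 0" unfolding \<tau>_def by (rule suminf_exist_split2[OF sm])
    show "0 \<le> \<tau> h n" for n
      unfolding \<tau>_def using sm by (intro suminf_nonneg summable_ignore_initial_segment) auto
  qed
  \<comment> \<open>The added \<open>inverse (real (Suc n))\<close> makes \<open>A n\<close>
    strictly positive even when both tails vanish.\<close>
  define A where "A = (\<lambda>n. sqrt (\<tau> f n + \<tau> g n + inverse (real (Suc n))))"
  have A0: "0 < A n" for n
    using \<tau>(2)[OF fg(2), of n] \<tau>(2)[OF fg(3), of n] by (simp add: A_def add_nonneg_pos)
  have A2: "(A n)\<^sup>2 = \<tau> f n + \<tau> g n + inverse (real (Suc n))" for n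
    using \<tau>(2)[OF fg(2), of n] \<tau>(2)[OF fg(3), of n] by (simp add: A_def)
  have "A \<longlonglongrightarrow> sqrt (0 + 0 + 0)"
    unfolding A_def
    by (intro tendsto_intros \<tau>(1)[OF fg(2)] \<tau>(1)[OF fg(3)] LIMSEQ_inverse_real_of_nat)
  then have "(\<lambda>n. 10 * A n * sqrt (M + 1)) \<longlonglongrightarrow> 10 * 0 * sqrt (M + 1)"
    by (intro tendsto_intros) simp
  moreover have "norm (D h - poly_op (poly_of_seq f n * poly_of_seq g n) (2 * n) h) \<le> 10 * A n * sqrt (M + 1) * norm h"
    for n h
  proof (rule norm_D_minus_poly_op_le[OF fg(1)])
    show "(\<Sum>i<K. (cmod (f i))\<^sup>2) \<le> (sqrt (M + 1))\<^sup>2" "(\<Sum>i<K. (cmod (g i))\<^sup>2) \<le> (sqrt (M + 1))\<^sup>2" for K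
      using fg(2,3) M by simp_all
    show "0 < sqrt (M + 1)" using M by simp
    show "(\<Sum>i. (cmod (f (i + n)))\<^sup>2) \<le> (A n)\<^sup>2" "(\<Sum>i. (cmod (g (i + n)))\<^sup>2) \<le> (A n)\<^sup>2"
      using \<tau>(2)[OF fg(2), of n] \<tau>(2)[OF fg(3), of n] unfolding A2 by (simp_all add: \<tau>_def)
  qed (rule A0)
  ultimately show ?thesis
    by (intro that[of "\<lambda>n. poly_of_seq f n * poly_of_seq g n" "\<lambda>n. 10 * A n * sqrt (M + 1)"])
      (use A0 M in \<open>auto intro: less_imp_le\<close>)
qed

lemma approximable_D: "approximable D"
proof -
  obtain P \<eta> where P: "\<And>n h. norm (D h - poly_op (P n) (2 * n) h) \<le> \<eta> n * norm h" "\<And>n. 0 \<le> \<eta> n"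
    and \<eta>: "\<eta> \<longlonglongrightarrow> 0"
    by (rule finite_rank_approximation) blast
  have bl: "bounded_linear (\<lambda>h. D h - poly_op (P n) (2 * n) h)" for n
    using bounded_clinear_finite_rank_op
    by (intro bounded_linear_sub bounded_linear_D) (auto simp: poly_op_def bounded_clinear_def)
  have "(\<lambda>n. onorm (\<lambda>h. D h - poly_op (P n) (2 * n) h)) \<longlonglongrightarrow> 0"
  proof (rule Lim_null_comparison[OF _ \<eta>])
    have "onorm (\<lambda>h. D h - poly_op (P n) (2 * n) h) \<le> \<eta> n" for n using P by (intro onorm_bound)
    then show "\<forall>\<^sub>F n in sequentially. norm (onorm (\<lambda>h. D h - poly_op (P n) (2 * n) h)) \<le> \<eta> n"
      using onorm_pos_le[OF bl] by simp
  qed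
  then show ?thesis
    unfolding approximable_def
    by (intro conjI bounded_clinear_D exI[of _ "\<lambda>n. poly_op (P n) (2 * n)"])
      (simp_all add: poly_op_def bounded_clinear_finite_rank_op finite_rank_finite_rank_op)
qed

lemma compact_operator_D: "compact_operator D"
proof (rule compact_operator_limit[OF bounded_clinear_D])
  fix e :: real assume e: "0 < e"
  obtain P \<eta> where P: "\<And>n h. norm (D h - poly_op (P n) (2 * n) h) \<le> \<eta> n * norm h" "\<And>n. 0 \<le> \<eta> n"
    and \<eta>: "\<eta> \<longlonglongrightarrow> 0"
    by (rule finite_rank_approximation) blast
  obtain n where n: "\<eta> n < e"
    using eventually_happens'[OF sequentially_bot order_tendstoD(2)[OF \<eta> e]] by blast
  have "norm (D h - poly_op (P n) (2 * n) h) < e" if "norm h \<le> 1" for h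
    using P(1)[of h n] mult_left_le[OF that P(2)[of n]] n by linarith
  then show "\<exists>\<phi> \<psi> K. \<forall>u. norm u \<le> 1 \<longrightarrow> norm (D u - finite_rank_op \<phi> \<psi> K u) < e"
    unfolding poly_op_def by blast
qed

end

theorem corollary3p2:
  fixes D :: "disc_algebra \<Rightarrow> disc_algebra cdual"
  assumes "D \<in> bounded_derivations"
  shows "approximable D \<and> compact_operator D"
proof -
  interpret disc_derivation D by unfold_locales (rule assms)
  show ?thesis using approximable_D compact_operator_D by blast
qed

end
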